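(* Let $\alpha\in(0,1)$ be irrational, and for each $n$ let $\mathbf{G}_n^1,\mathbf{G}_n^2$ be two independent samples of the binomial random graph $G(n,n^{-\alpha})$. Let $\mathbf{k}_\alpha=\mathbf{k}_\alpha(n)=k(\mathbf{G}_n^1,\mathbf{G}_n^2)$. Then $\mathbf{k}_{\alpha}=O_{p}\left(\frac{\ln n}{\ln\ln n}\right)$.
   Context: Graphs are finite simple graphs; the first order (FO) language of graphs has the adjacency and equality relations. A FO sentence $\varphi$ distinguishes graphs $G_1,G_2$ if exactly one of them satisfies $\varphi$. The FO distinguishability $k(G_1,G_2)$ is the minimum quantifier depth of a FO sentence distinguishing $G_1$ and $G_2$. $G(n,p)$ is the random graph on $[n]=\{1,\dots,n\}$ in which each pair is an edge independently with probability $p$. For random variables $\xi_n$ and nonzero constants $a_n$, $\xi_n=O_p(a_n)$ means that for every $\varepsilon>0$ there is $C>0$ with $\mathbb{P}(|\xi_n/a_n|<C)>1-\varepsilon$ for all $n$.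
   Formalization: k is taken to be infinity on isomorphic graphs, and the bound in O_p is required only for all sufficiently large n (depending on ε), since for each fixed n the two samples are isomorphic with positive probability and ln n/ln ln n is undefined at n=1. *)

theory Defs
  imports "HOL-Probability.Probability"
begin

type_synonym 'v graph = "'v set \<times> 'v set set"

definition vertex_pairs :: "'v set \<Rightarrow> 'v set set" where
  "vertex_pairs V = {e. e \<subseteq> V \<and> card e = 2}"

definition simple_graph :: "'v graph \<Rightarrow> bool" where
  "simple_graph G \<longleftrightarrow> finite (fst G) \<and> snd G \<subseteq> vertex_pairs (fst G)"

datatype fo =
    Eq nat nat
  | Adj nat nat
  | Neg fo
  | Conj fo fo
  | Disj fo fo
  | Impl fo fo
  | Exists nat fo
  | Forall nat fo

fun free_vars :: "fo \<Rightarrow> nat set" where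
  "free_vars (Eq x y) = {x, y}"
| "free_vars (Adj x y) = {x, y}"
| "free_vars (Neg \<phi>) = free_vars \<phi>"
| "free_vars (Conj \<phi> \<psi>) = free_vars \<phi> \<union> free_vars \<psi>"
| "free_vars (Disj \<phi> \<psi>) = free_vars \<phi> \<union> free_vars \<psi>"
| "free_vars (Impl \<phi> \<psi>) = free_vars \<phi> \<union> free_vars \<psi>"
| "free_vars (Exists x \<phi>) = free_vars \<phi> - {x}"
| "free_vars (Forall x \<phi>) = free_vars \<phi> - {x}"

definition sentence :: "fo \<Rightarrow> bool" where
  "sentence \<phi> \<longleftrightarrow> free_vars \<phi> = {}"

fun qdepth :: "fo \<Rightarrow> nat" where
  "qdepth (Eq x y) = 0"
| "qdepth (Adj x y) = 0"
| "qdepth (Neg \<phi>) = qdepth \<phi>"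
| "qdepth (Conj \<phi> \<psi>) = max (qdepth \<phi>) (qdepth \<psi>)"
| "qdepth (Disj \<phi> \<psi>) = max (qdepth \<phi>) (qdepth \<psi>)"
| "qdepth (Impl \<phi> \<psi>) = max (qdepth \<phi>) (qdepth \<psi>)"
| "qdepth (Exists x \<phi>) = Suc (qdepth \<phi>)"
| "qdepth (Forall x \<phi>) = Suc (qdepth \<phi>)"

fun sat :: "'v graph \<Rightarrow> (nat \<Rightarrow> 'v) \<Rightarrow> fo \<Rightarrow> bool" where
  "sat G s (Eq x y) \<longleftrightarrow> s x = s y"
| "sat G s (Adj x y) \<longleftrightarrow> {s x, s y} \<in> snd G"
| "sat G s (Neg \<phi>) \<longleftrightarrow> \<not> sat G s \<phi>"
| "sat G s (Conj \<phi> \<psi>) \<longleftrightarrow> sat G s \<phi> \<and> sat G s \<psi>"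
| "sat G s (Disj \<phi> \<psi>) \<longleftrightarrow> sat G s \<phi> \<or> sat G s \<psi>"
| "sat G s (Impl \<phi> \<psi>) \<longleftrightarrow> (sat G s \<phi> \<longrightarrow> sat G s \<psi>)"
| "sat G s (Exists x \<phi>) \<longleftrightarrow> (\<exists>v\<in>fst G. sat G (s(x := v)) \<phi>)"
| "sat G s (Forall x \<phi>) \<longleftrightarrow> (\<forall>v\<in>fst G. sat G (s(x := v)) \<phi>)"

lemma sat_cong:
  assumes "\<And>x. x \<in> free_vars \<phi> \<Longrightarrow> s x = t x"
  shows "sat G s \<phi> \<longleftrightarrow> sat G t \<phi>"
  using assms
proof (induction \<phi> arbitrary: s t)
  case (Exists x \<phi>)
  have "sat G (s(x := v)) \<phi> \<longleftrightarrow> sat G (t(x := v)) \<phi>" for v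
    by (rule Exists.IH) (use Exists.prems in auto)
  then show ?case by simp
next
  case (Forall x \<phi>)
  have "sat G (s(x := v)) \<phi> \<longleftrightarrow> sat G (t(x := v)) \<phi>" for v
    by (rule Forall.IH) (use Forall.prems in auto)
  then show ?case by simp
next
  case (Neg \<phi>)
  then have "sat G s \<phi> \<longleftrightarrow> sat G t \<phi>" by (intro Neg.IH) auto
  then show ?case by simp
next
  case (Conj \<phi> \<psi>)
  have "sat G s \<phi> \<longleftrightarrow> sat G t \<phi>" "sat G s \<psi> \<longleftrightarrow> sat G t \<psi>"
    by (rule Conj.IH(1), use Conj.prems in simp) (rule Conj.IH(2), use Conj.prems in simp)
  then show ?case by simp
next
  case (Disj \<phi> \<psi>)
  have "sat G s \<phi> \<longleftrightarrow> sat G t \<phi>" "sat G s \<psi> \<longleftrightarrow> sat G t \<psi>"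
    by (rule Disj.IH(1), use Disj.prems in simp) (rule Disj.IH(2), use Disj.prems in simp)
  then show ?case by simp
next
  case (Impl \<phi> \<psi>)
  have "sat G s \<phi> \<longleftrightarrow> sat G t \<phi>" "sat G s \<psi> \<longleftrightarrow> sat G t \<psi>"
    by (rule Impl.IH(1), use Impl.prems in simp) (rule Impl.IH(2), use Impl.prems in simp)
  then show ?case by simp
qed auto

text \<open>The truth value of a sentence does not depend on the assignment.\<close>

definition models :: "'v graph \<Rightarrow> fo \<Rightarrow> bool" (infix \<open>\<Turnstile>\<close> 50) where
  "G \<Turnstile> \<phi> \<longleftrightarrow> (\<forall>s. sat G s \<phi>)"

lemma models_sentence_iff: "sentence \<phi> \<Longrightarrow> G \<Turnstile> \<phi> \<longleftrightarrow> sat G s \<phi>"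
  unfolding models_def sentence_def using sat_cong[of \<phi> _ s G] by blast

definition distinguishes :: "fo \<Rightarrow> 'v graph \<Rightarrow> 'w graph \<Rightarrow> bool" where
  "distinguishes \<phi> G H \<longleftrightarrow> (G \<Turnstile> \<phi>) \<noteq> (H \<Turnstile> \<phi>)"

text \<open>The infimum of the empty set is \<open>\<infinity>\<close>, so isomorphic graphs have
  distinguishability \<open>\<infinity>\<close>.\<close>

definition fo_distinguishability :: "'v graph \<Rightarrow> 'w graph \<Rightarrow> enat" where
  "fo_distinguishability G H =
     Inf {enat (qdepth \<phi>) | \<phi>. sentence \<phi> \<and> distinguishes \<phi> G H}"

definition random_graph :: "nat \<Rightarrow> real \<Rightarrow> nat graph pmf" where
  "random_graph n p =
     map_pmf (\<lambda>f. ({1..n}, {e \<in> vertex_pairs {1..n}. f e}))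
       (Pi_pmf (vertex_pairs {1..n}) False (\<lambda>_. bernoulli_pmf p))"

lemma simple_graph_random_graph: "G \<in> set_pmf (random_graph n p) \<Longrightarrow> simple_graph G"
  by (auto simp: random_graph_def simple_graph_def)

text \<open>Stochastic boundedness of \<open>\<xi> n / a n\<close>, where \<open>\<xi> n\<close> lives on the probability space \<open>M n\<close>
  and may take the value \<open>\<infinity>\<close> with positive probability for every single \<open>n\<close>
  (two samples of a random graph may be isomorphic). A bound by the same finite \<open>C\<close> can then only
  be required from some index on, depending on \<open>\<epsilon>\<close>. If every \<open>\<xi> n\<close> is almost surely finite
  and every \<open>a n\<close> is nonzero, this is the same as requiring it for all \<open>n\<close>, after enlarging \<open>C\<close>.\<close>

definition bigo_p :: "(nat \<Rightarrow> 'a measure) \<Rightarrow> (nat \<Rightarrow> 'a \<Rightarrow> ereal) \<Rightarrow> (nat \<Rightarrow> real) \<Rightarrow> bool" where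
  "bigo_p M \<xi> a \<longleftrightarrow>
     (\<forall>\<epsilon>>0. \<exists>C>0. \<forall>\<^sub>F n in sequentially.
        measure (M n) {x \<in> space (M n). \<bar>\<xi> n x / ereal (a n)\<bar> < ereal C} > 1 - \<epsilon>)"

end

theory Submission
  imports Defs "HOL-Real_Asymp.Real_Asymp"
begin

text \<open>
  With high probability \<open>G1\<close> contains a subgraph with \<open>v = O(ln n / ln ln n)\<close> vertices and \<open>e\<close> edges
  such that \<open>n ^ v * p ^ e \<le> 1 / n\<close>. Such a subgraph is too dense for any fixed graph of its shape to
  appear in the independent graph \<open>G2\<close>, so the sentence ``there is a copy of this graph'', of depth
  \<open>v\<close>, distinguishes \<open>G1\<close> from \<open>G2\<close>.

  \<open>G1\<close> nevertheless contains such a subgraph because there are \<open>v ^ \<Omega>(v)\<close>, a power of \<open>n\<close>, shapes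
  to choose from. A shape is a path on \<open>v\<close> vertices, with about \<open>(1 / \<alpha> - 1) * v\<close> further edges
  whose first endpoints are spread evenly along the path, as in a Sturmian word, and whose
  second endpoints are free up to a bound on the degree. In the second moment, a run of
  \<open>l\<close> path vertices containing \<open>s\<close> first endpoints that is shared by two copies costs about
  \<open>n powr (\<alpha> * (s - 1) - (1 - \<alpha>) * l) * v powr (- s)\<close>. The exponent of \<open>n\<close> is at most of order
  \<open>s * ln ln n / ln n\<close>, which the factor \<open>v powr (- s)\<close> absorbs, and for bounded \<open>s\<close> it is
  bounded away from \<open>0\<close> because \<open>\<alpha>\<close> is irrational.
\<close>

subsection \<open>Sentences expressing the existence of a copy\<close>

text \<open>\<open>Eq 0 0\<close> serves as truth, for which \<open>fo\<close> has no constant. It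
  leaves variable 0 free, so at least one quantifier is needed to close the formula; hence
  \<open>v > 0\<close> in \<open>sentence_copy_sentence\<close>.\<close>

fun conjs :: "fo list \<Rightarrow> fo" where
  "conjs [] = Eq 0 0"
| "conjs (\<phi> # \<phi>s) = Conj \<phi> (conjs \<phi>s)"

fun exists_below :: "nat \<Rightarrow> fo \<Rightarrow> fo" where
  "exists_below 0 \<phi> = \<phi>"
| "exists_below (Suc k) \<phi> = Exists k (exists_below k \<phi>)"

lemma sat_conjs: "sat G s (conjs \<phi>s) \<longleftrightarrow> (\<forall>\<phi>\<in>set \<phi>s. sat G s \<phi>)"
  by (induction \<phi>s) auto

lemma free_vars_conjs: "free_vars (conjs \<phi>s) \<subseteq> insert 0 (\<Union>(free_vars ` set \<phi>s))"
  by (induction \<phi>s) auto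

lemma qdepth_conjs: "(\<And>\<phi>. \<phi> \<in> set \<phi>s \<Longrightarrow> qdepth \<phi> = 0) \<Longrightarrow> qdepth (conjs \<phi>s) = 0"
  by (induction \<phi>s) auto

lemma free_vars_exists_below: "free_vars (exists_below k \<phi>) = free_vars \<phi> - {..<k}"
  by (induction k) (auto simp: lessThan_Suc)

lemma qdepth_exists_below: "qdepth (exists_below k \<phi>) = k + qdepth \<phi>"
  by (induction k) auto

lemma sat_exists_below:
  "sat G s (exists_below k \<phi>) \<longleftrightarrow>
     (\<exists>x. (\<forall>i<k. x i \<in> fst G) \<and> (\<forall>i\<ge>k. x i = s i) \<and> sat G x \<phi>)"
proof (induction k arbitrary: s)
  case 0
  have "x = s" if "\<forall>i. x i = s i" for x using that by auto
  then show ?case by auto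
next
  case (Suc k)
  have "(\<exists>v\<in>fst G. \<exists>x. (\<forall>i<k. x i \<in> fst G) \<and> (\<forall>i\<ge>k. x i = (s(k := v)) i) \<and> sat G x \<phi>)
     \<longleftrightarrow> (\<exists>x. (\<forall>i<Suc k. x i \<in> fst G) \<and> (\<forall>i\<ge>Suc k. x i = s i) \<and> sat G x \<phi>)" (is "?L \<longleftrightarrow> ?R")
  proof
    assume ?L
    then obtain v x where vx: "v \<in> fst G" "\<forall>i<k. x i \<in> fst G" "\<forall>i\<ge>k. x i = (s(k := v)) i" "sat G x \<phi>"
      by auto
    then have "x k = v" by auto
    then have "(\<forall>i<Suc k. x i \<in> fst G) \<and> (\<forall>i\<ge>Suc k. x i = s i) \<and> sat G x \<phi>"
      using vx by (auto simp: less_Suc_eq)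
    then show ?R by blast
  next
    assume ?R
    then obtain x where x: "\<forall>i<Suc k. x i \<in> fst G" "\<forall>i\<ge>Suc k. x i = s i" "sat G x \<phi>" by auto
    then have "x k \<in> fst G" "\<forall>i<k. x i \<in> fst G" "\<forall>i\<ge>k. x i = (s(k := x k)) i"
      by (auto simp: Suc_le_eq)
    then show ?L using x by blast
  qed
  then show ?case by (simp add: Suc)
qed

text \<open>Copies need not be induced: only the edges of \<open>H\<close> are prescribed, so the
  probability of a fixed copy is a plain power of \<open>p\<close>.\<close>

definition contains_copy :: "nat \<Rightarrow> nat set set \<Rightarrow> 'v graph \<Rightarrow> bool" where
  "contains_copy v H G \<longleftrightarrow>
     (\<exists>x. x ` {..<v} \<subseteq> fst G \<and> inj_on x {..<v} \<and> (`) x ` H \<subseteq> snd G)"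

text \<open>Used for all ordered pairs, the diagonal included, where the first conjunct is trivially
  true; \<open>Eq i i\<close> is a filler for pairs that impose no adjacency.\<close>

definition copy_atoms :: "nat set set \<Rightarrow> nat \<Rightarrow> nat \<Rightarrow> fo" where
  "copy_atoms H i j =
     Conj (if i = j then Eq i j else Neg (Eq i j)) (if {i, j} \<in> H then Adj i j else Eq i i)"

definition copy_body :: "nat \<Rightarrow> nat set set \<Rightarrow> fo" where
  "copy_body v H = conjs (map (\<lambda>i. conjs (map (copy_atoms H i) [0..<v])) [0..<v])"

definition copy_sentence :: "nat \<Rightarrow> nat set set \<Rightarrow> fo" where
  "copy_sentence v H = exists_below v (copy_body v H)"

lemma sat_copy_body:
  "sat G x (copy_body v H) \<longleftrightarrow>
   (\<forall>i<v. \<forall>j<v. (i \<noteq> j \<longrightarrow> x i \<noteq> x j) \<and> ({i, j} \<in> H \<longrightarrow> {x i, x j} \<in> snd G))"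
proof -
  have "sat G x (copy_atoms H i j) \<longleftrightarrow>
      (i \<noteq> j \<longrightarrow> x i \<noteq> x j) \<and> ({i, j} \<in> H \<longrightarrow> {x i, x j} \<in> snd G)" for i j
    by (simp add: copy_atoms_def)
  then show ?thesis
    unfolding copy_body_def sat_conjs by (simp add: sat_conjs atLeast0LessThan lessThan_iff) (simp add: Ball_def)
qed

text \<open>The atoms see exactly the edges \<open>{i, j}\<close> with \<open>i\<close> and
  \<open>j\<close> below \<open>v\<close>; by the assumption on \<open>H\<close> these are all its
  edges.\<close>

lemma sat_copy_sentence:
  assumes "H \<subseteq> vertex_pairs {..<v}"
  shows "sat G s (copy_sentence v H) \<longleftrightarrow> contains_copy v H G"
proof
  assume "sat G s (copy_sentence v H)"
  then obtain x where x1: "\<forall>i<v. x i \<in> fst G" and "sat G x (copy_body v H)"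
    unfolding copy_sentence_def sat_exists_below by blast
  then have x2: "x i \<noteq> x j" if "i < v" "j < v" "i \<noteq> j" for i j
    using that unfolding sat_copy_body by simp
  have x3: "{x i, x j} \<in> snd G" if "i < v" "j < v" "{i, j} \<in> H" for i j
    using \<open>sat G x (copy_body v H)\<close> that unfolding sat_copy_body by simp
  have "x ` e \<in> snd G" if "e \<in> H" for e
  proof -
    have "e \<subseteq> {..<v}" "card e = 2" using that assms by (auto simp: vertex_pairs_def)
    then obtain i j where "e = {i, j}" "i < v" "j < v" by (auto simp: card_2_iff)
    then show ?thesis using x3 that by simp
  qed
  moreover have "inj_on x {..<v}" using x2 by (meson inj_onI lessThan_iff)
  ultimately show "contains_copy v H G"
    unfolding contains_copy_def using x1 by (intro exI[of _ x]) (simp add: image_subset_iff)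
next
  assume "contains_copy v H G"
  then obtain x where x: "x ` {..<v} \<subseteq> fst G" "inj_on x {..<v}" "(`) x ` H \<subseteq> snd G"
    unfolding contains_copy_def by blast
  \<comment> \<open>The quantifiers rebind only the variables below \<open>v\<close>, so the witness
    has to agree with \<open>s\<close> elsewhere.\<close>
  define y where "y i = (if i < v then x i else s i)" for i
  have e: "{x i, x j} \<in> snd G" if "{i, j} \<in> H" for i j
    using x(3) imageI[OF that, of "(`) x"] by auto
  have "x i \<noteq> x j" if "i < v" "j < v" "i \<noteq> j" for i j
    using x(2) that by (auto dest: inj_onD)
  then have "sat G y (copy_body v H)"
    unfolding sat_copy_body using e by (simp add: y_def)
  moreover have "(\<forall>i<v. y i \<in> fst G) \<and> (\<forall>i\<ge>v. y i = s i)"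
    using x(1) by (auto simp: y_def)
  ultimately show "sat G s (copy_sentence v H)"
    unfolding copy_sentence_def sat_exists_below by blast
qed

lemma sentence_copy_sentence:
  assumes "v > 0"
  shows "sentence (copy_sentence v H)"
proof -
  have "free_vars (copy_atoms H i j) \<subseteq> {..<v}" if "i < v" "j < v" for i j
    using that by (simp add: copy_atoms_def)
  then have "free_vars (conjs (map (copy_atoms H i) [0..<v])) \<subseteq> {..<v}" if "i < v" for i
    by (intro order_trans[OF free_vars_conjs]) (use assms that in \<open>simp add: UN_subset_iff\<close>)
  then have "free_vars (copy_body v H) \<subseteq> {..<v}"
    unfolding copy_body_def
    by (intro order_trans[OF free_vars_conjs]) (use assms in \<open>simp add: UN_subset_iff\<close>)
  then show ?thesis
    unfolding sentence_def copy_sentence_def free_vars_exists_below by blast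
qed

lemma qdepth_copy_sentence: "qdepth (copy_sentence v H) = v"
proof -
  have "qdepth (copy_body v H) = 0"
    unfolding copy_body_def by (intro qdepth_conjs) (force intro: qdepth_conjs simp: copy_atoms_def)
  then show ?thesis unfolding copy_sentence_def qdepth_exists_below by simp
qed

lemma fo_distinguishability_le:
  assumes "H \<subseteq> vertex_pairs {..<v}" "v > 0" "contains_copy v H G1" "\<not> contains_copy v H G2"
  shows "fo_distinguishability G1 G2 \<le> enat v"
  unfolding fo_distinguishability_def
proof (rule Inf_lower, clarify, intro exI conjI)
  show "sentence (copy_sentence v H)" by (rule sentence_copy_sentence[OF \<open>v > 0\<close>])
  show "distinguishes (copy_sentence v H) G1 G2"
    unfolding distinguishes_def models_def sat_copy_sentence[OF assms(1)] using assms by simp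
qed (simp add: qdepth_copy_sentence)

subsection \<open>Paths with additional edges\<close>

definition path_edges :: "nat \<Rightarrow> nat set set" where
  "path_edges v = (\<lambda>i. {i, Suc i}) ` {..<v - 1}"

definition edge_degree :: "'v set set \<Rightarrow> 'v \<Rightarrow> nat" where
  "edge_degree E y = card {e \<in> E. y \<in> e}"

lemma finite_vertex_pairs: "finite V \<Longrightarrow> finite (vertex_pairs V)"
  unfolding vertex_pairs_def by (rule finite_subset[of _ "Pow V"]) auto

lemma path_edges_subset: "path_edges v \<subseteq> vertex_pairs {..<v}"
  by (auto simp: path_edges_def vertex_pairs_def)

lemma card_path_edges: "card (path_edges v) = v - 1"
proof -
  have "inj_on (\<lambda>i. {i, Suc i}) {..<v - 1}" by (auto simp: inj_on_def doubleton_eq_iff)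
  then show ?thesis by (simp add: path_edges_def card_image)
qed

lemma edge_degree_path_edges: "edge_degree (path_edges v) i \<le> 2"
proof -
  have "{e \<in> path_edges v. i \<in> e} \<subseteq> {{i, Suc i}, {i - 1, i}}"
    by (auto simp: path_edges_def)
  then have "edge_degree (path_edges v) i \<le> card {{i, Suc i}, {i - 1, i}}"
    unfolding edge_degree_def by (intro card_mono) auto
  also have "\<dots> \<le> 2" by (simp add: card_insert_if)
  finally show ?thesis .
qed

text \<open>Handshake lemma, by counting incidences of vertices and edges in two ways.\<close>

lemma sum_edge_degree:
  assumes "finite V" "E \<subseteq> vertex_pairs V"
  shows "(\<Sum>y\<in>V. edge_degree E y) = 2 * card E"
proof -
  have fin: "finite E" using assms finite_vertex_pairs finite_subset by blast
  have "(\<Sum>y\<in>V. edge_degree E y) = (\<Sum>y\<in>V. \<Sum>e\<in>E. if y \<in> e then 1 else 0)"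
    unfolding edge_degree_def using fin by (simp add: sum.If_cases Int_def)
  also have "\<dots> = (\<Sum>e\<in>E. \<Sum>y\<in>V. if y \<in> e then 1 else 0)" by (rule sum.swap)
  also have "\<dots> = (\<Sum>e\<in>E. 2)"
  proof (rule sum.cong[OF refl])
    fix e assume "e \<in> E"
    then have "e \<subseteq> V" "card e = 2" using assms(2) by (auto simp: vertex_pairs_def)
    then show "(\<Sum>y\<in>V. if y \<in> e then 1 else 0) = (2::nat)"
      using assms(1) by (simp add: sum.If_cases Int_absorb1 flip: Int_def)
  qed
  finally show ?thesis by simp
qed

lemma card_neighbours_le_edge_degree:
  assumes "finite E"
  shows "card {j \<in> V. j \<noteq> i \<and> {i, j} \<in> E} \<le> edge_degree E i"
proof -
  have "inj_on (\<lambda>j. {i, j}) {j \<in> V. j \<noteq> i \<and> {i, j} \<in> E}"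
    by (auto simp: inj_on_def doubleton_eq_iff)
  then show ?thesis
    unfolding edge_degree_def using assms by (intro card_inj_on_le[where f = "\<lambda>j. {i, j}"]) auto
qed

lemma edge_degree_insert_le:
  assumes "finite E"
  shows "edge_degree (insert e E) y \<le> edge_degree E y + (if y \<in> e then 1 else 0)"
proof -
  have "{e' \<in> insert e E. y \<in> e'} \<subseteq> (if y \<in> e then {e} else {}) \<union> {e' \<in> E. y \<in> e'}" by auto
  then have "edge_degree (insert e E) y \<le> card ((if y \<in> e then {e} else {}) \<union> {e' \<in> E. y \<in> e'})"
    unfolding edge_degree_def using assms by (intro card_mono) auto
  also have "\<dots> \<le> card (if y \<in> e then {e} else {}) + edge_degree E y"
    unfolding edge_degree_def by (rule card_Un_le)
  finally show ?thesis by (simp split: if_splits)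
qed

text \<open>By the handshake lemma at most \<open>z\<close> vertices have degree \<open>D\<close> or
  more. Besides these only \<open>i\<close> and its at most \<open>D + R\<close> neighbours are
  excluded, which leaves \<open>m\<close> of the \<open>v\<close> vertices.\<close>

lemma many_admissible_targets:
  assumes E: "E \<subseteq> vertex_pairs {..<v}" "2 * card E \<le> D * z" "D > 0"
    and deg: "edge_degree E i \<le> D + R" and v: "z + D + R + 1 + m \<le> v"
  shows "m \<le> card {j \<in> {..<v}. j \<noteq> i \<and> {i, j} \<notin> E \<and> edge_degree E j < D}" (is "_ \<le> card ?T")
proof -
  have fin: "finite E" using E finite_vertex_pairs finite_subset by blast
  define N where "N = {j \<in> {..<v}. j \<noteq> i \<and> {i, j} \<in> E}"
  define Z where "Z = {j \<in> {..<v}. D \<le> edge_degree E j}"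
  have "D * card Z = (\<Sum>j\<in>Z. D)" by simp
  also have "\<dots> \<le> (\<Sum>j\<in>Z. edge_degree E j)" by (rule sum_mono) (auto simp: Z_def)
  also have "\<dots> \<le> (\<Sum>j<v. edge_degree E j)" by (rule sum_mono2) (auto simp: Z_def)
  also have "\<dots> \<le> D * z" using E sum_edge_degree[of "{..<v}" E] by simp
  finally have Z: "card Z \<le> z" using \<open>D > 0\<close> by simp
  have N: "card N \<le> D + R"
    unfolding N_def using card_neighbours_le_edge_degree[OF fin, of "{..<v}" i] deg by linarith
  have "{..<v} \<subseteq> ?T \<union> ({i} \<union> (N \<union> Z))" by (auto simp: N_def Z_def)
  then have "v \<le> card (?T \<union> ({i} \<union> (N \<union> Z)))"
    by (subst card_lessThan[symmetric], intro card_mono) (auto simp: N_def Z_def)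
  also have "\<dots> \<le> card ?T + card ({i} \<union> (N \<union> Z))" by (rule card_Un_le)
  also have "card ({i} \<union> (N \<union> Z)) \<le> 1 + card (N \<union> Z)"
    using card_Un_le[of "{i}"] by simp
  also have "card (N \<union> Z) \<le> card N + card Z" by (rule card_Un_le)
  finally show ?thesis using N Z v by linarith
qed

text \<open>Slot \<open>k\<close> is an edge from the vertex \<open>q k\<close> to one of \<open>m\<close> admissible targets; the targets are
  chosen one after the other, the admissible ones depending on the previous choices.\<close>

lemma slot_graph_family:
  fixes q :: "nat \<Rightarrow> nat" and v m D R z K :: nat
  assumes "D \<ge> 2" "m > 0" and v: "z + D + R + 1 + m \<le> v" and K: "2 * (v + K) \<le> D * z"
    and q: "\<And>k. k < K \<Longrightarrow> q k < v"
    and R: "\<And>i. card {k. k < K \<and> q k = i} \<le> R"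
  obtains I :: "nat list set" and \<Gamma> :: "nat list \<Rightarrow> nat set set"
  where "finite I" "I \<noteq> {}"
    and "\<And>u. u \<in> I \<Longrightarrow> \<Gamma> u \<subseteq> vertex_pairs {..<v}"
    and "\<And>u. u \<in> I \<Longrightarrow> card (\<Gamma> u) = v - 1 + K"
    and "\<And>u i. u \<in> I \<Longrightarrow> edge_degree (\<Gamma> u) i \<le> D + R"
    and "\<And>(x :: nat \<Rightarrow> 'v) E X \<Delta> P. inj_on x {..<v} \<Longrightarrow> finite E \<Longrightarrow> \<Union>E \<subseteq> X \<Longrightarrow>
           \<forall>y. edge_degree E y \<le> \<Delta> \<Longrightarrow> (1::real) \<le> P \<Longrightarrow>
           (\<Sum>u\<in>I. P ^ card ((`) x ` \<Gamma> u \<inter> E)) \<le>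
             card I * (P ^ card ((`) x ` path_edges v \<inter> E) *
               (\<Prod>k<K. if x (q k) \<in> X then 1 + P * \<Delta> / m else 1))"
proof -
  \<comment> \<open>Invariant after \<open>k\<close> slots. A vertex has degree at most
    \<open>D\<close> plus the number of its own slots so far, because targets are taken only among
    vertices of degree below \<open>D\<close>. The weighted sum is an averaged overlap with a fixed
    edge set \<open>E\<close>: the path is kept exactly, and each slot contributes one factor. At
    the start the path has degrees at most 2, hence \<open>D \<ge> 2\<close>.\<close>
  define good where "good k I \<Gamma> \<longleftrightarrow> finite I \<and> I \<noteq> {} \<and>
     (\<forall>u\<in>I. \<Gamma> u \<subseteq> vertex_pairs {..<v} \<and> card (\<Gamma> u) = v - 1 + k \<and>
        (\<forall>i. edge_degree (\<Gamma> u) i \<le> D + card {k'. k' < k \<and> q k' = i})) \<and>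
     (\<forall>(x :: nat \<Rightarrow> 'v) E X \<Delta> P. inj_on x {..<v} \<longrightarrow> finite E \<longrightarrow> \<Union>E \<subseteq> X \<longrightarrow>
        (\<forall>y. edge_degree E y \<le> \<Delta>) \<longrightarrow> (1::real) \<le> P \<longrightarrow>
        (\<Sum>u\<in>I. P ^ card ((`) x ` \<Gamma> u \<inter> E)) \<le>
             card I * (P ^ card ((`) x ` path_edges v \<inter> E) *
               (\<Prod>k<k. if x (q k) \<in> X then 1 + P * \<Delta> / m else 1)))"
    for k and I :: "nat list set" and \<Gamma>
  have "\<exists>I \<Gamma>. good k I \<Gamma>"
    if "k \<le> K" for k
    using that
  proof (induction k)
    case 0
    show ?case unfolding good_def
      using path_edges_subset[of v] card_path_edges[of v] edge_degree_path_edges[of v] \<open>D \<ge> 2\<close>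
      by (intro exI[of _ "{[]}"] exI[of _ "\<lambda>_. path_edges v"]) (auto intro: order_trans)
  next
    case (Suc k)
    then obtain I \<Gamma> where IG: "good k I \<Gamma>" by auto
    have I: "finite I" "I \<noteq> {}" using IG unfolding good_def by blast+
    have G1: "\<And>u. u \<in> I \<Longrightarrow> \<Gamma> u \<subseteq> vertex_pairs {..<v}"
      and G2: "\<And>u. u \<in> I \<Longrightarrow> card (\<Gamma> u) = v - 1 + k"
      and G3: "\<And>u i. u \<in> I \<Longrightarrow> edge_degree (\<Gamma> u) i \<le> D + card {k'. k' < k \<and> q k' = i}"
      using IG unfolding good_def by blast+
    have G4: "(\<Sum>u\<in>I. P ^ card ((`) x ` \<Gamma> u \<inter> E)) \<le>
             card I * (P ^ card ((`) x ` path_edges v \<inter> E) *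
               (\<Prod>k<k. if x (q k) \<in> X then 1 + P * \<Delta> / m else 1))"
      if "inj_on x {..<v}" "finite E" "\<Union>E \<subseteq> X" "\<forall>y. edge_degree E y \<le> \<Delta>" "1 \<le> P"
      for x :: "nat \<Rightarrow> 'v" and E X \<Delta> and P :: real
      using IG that unfolding good_def by blast
    define i where "i = q k"
    have "k < K" using Suc.prems by simp
    then have iv: "i < v" using q by (simp add: i_def)
    have fin: "finite (\<Gamma> u)" if "u \<in> I" for u
      using G1[OF that] finite_vertex_pairs finite_subset by blast
    have "\<exists>J. J \<subseteq> {j \<in> {..<v}. j \<noteq> i \<and> {i, j} \<notin> \<Gamma> u \<and> edge_degree (\<Gamma> u) j < D} \<and> card J = m"
      if u: "u \<in> I" for u
    proof -
      have "card {k'. k' < k \<and> q k' = i} \<le> card {k'. k' < K \<and> q k' = i}"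
        using \<open>k < K\<close> by (intro card_mono) auto
      then have "edge_degree (\<Gamma> u) i \<le> D + R"
        using G3[OF u, of i] R[of i] by linarith
      moreover have "2 * card (\<Gamma> u) \<le> 2 * (v + K)"
        using G2[OF u] \<open>k < K\<close> by simp
      ultimately have "m \<le> card {j \<in> {..<v}. j \<noteq> i \<and> {i, j} \<notin> \<Gamma> u \<and> edge_degree (\<Gamma> u) j < D}"
        using K v \<open>D \<ge> 2\<close> by (intro many_admissible_targets[OF G1[OF u]]) auto
      then show ?thesis by (meson obtain_subset_with_card_n)
    qed
    then have "\<forall>u\<in>I. \<exists>J. J \<subseteq> {j \<in> {..<v}. j \<noteq> i \<and> {i, j} \<notin> \<Gamma> u \<and> edge_degree (\<Gamma> u) j < D} \<and> card J = m"
      by (intro ballI)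
    from bchoice[OF this] obtain J where
      JJ: "\<forall>u\<in>I. J u \<subseteq> {j \<in> {..<v}. j \<noteq> i \<and> {i, j} \<notin> \<Gamma> u \<and> edge_degree (\<Gamma> u) j < D} \<and> card (J u) = m" ..
    have J: "J u \<subseteq> {j \<in> {..<v}. j \<noteq> i \<and> {i, j} \<notin> \<Gamma> u \<and> edge_degree (\<Gamma> u) j < D}"
      if "u \<in> I" for u
      by (rule conjunct1[OF bspec[OF JJ that]])
    have Jm: "card (J u) = m" if "u \<in> I" for u
      by (rule conjunct2[OF bspec[OF JJ that]])
    \<comment> \<open>The newest choice is the head of the list: \<open>hd w\<close> is the target
      of slot \<open>k\<close>, and \<open>tl w\<close> records the earlier choices.\<close>
    define I' where "I' = (\<lambda>(u, j). j # u) ` Sigma I J"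
    define \<Gamma>' where "\<Gamma>' w = insert {i, hd w} (\<Gamma> (tl w))" for w
    have finJ: "finite (J u)" if "u \<in> I" for u using J[OF that] finite_subset by fastforce
    have inj: "inj_on (\<lambda>(u, j). j # u) (Sigma I J)" by (auto simp: inj_on_def)
    have sum': "(\<Sum>w\<in>I'. f w) = (\<Sum>u\<in>I. \<Sum>j\<in>J u. f (j # u))" for f :: "nat list \<Rightarrow> real"
      unfolding I'_def sum.reindex[OF inj] using I finJ by (simp add: sum.Sigma split_beta)
    have "card I' = card I * m"
      unfolding I'_def card_image[OF inj] using I finJ Jm by (simp add: card_SigmaI)
    have "finite I'" unfolding I'_def using I finJ by auto
    have "I' \<noteq> {}"
      using \<open>card I' = card I * m\<close> I \<open>m > 0\<close> by (auto simp: card_eq_0_iff)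
    have step_props: "\<Gamma>' w \<subseteq> vertex_pairs {..<v} \<and> card (\<Gamma>' w) = v - 1 + Suc k \<and>
        (\<forall>y. edge_degree (\<Gamma>' w) y \<le> D + card {k'. k' < Suc k \<and> q k' = y})" if wI: "w \<in> I'" for w
    proof -
      obtain u j where w: "w = j # u" "u \<in> I" "j \<in> J u" using wI by (auto simp: I'_def)
      have j: "j < v" "j \<noteq> i" "{i, j} \<notin> \<Gamma> u" "edge_degree (\<Gamma> u) j < D" using J w by auto
      have eq: "\<Gamma>' w = insert {i, j} (\<Gamma> u)" by (simp add: \<Gamma>'_def w)
      have "edge_degree (\<Gamma>' w) y \<le> D + card {k'. k' < Suc k \<and> q k' = y}" for y
      proof -
        have d: "edge_degree (\<Gamma>' w) y \<le> edge_degree (\<Gamma> u) y + (if y \<in> {i, j} then 1 else 0)"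
          unfolding eq by (rule edge_degree_insert_le[OF fin[OF w(2)]])
        have mono: "card {k'. k' < k \<and> q k' = y} \<le> card {k'. k' < Suc k \<and> q k' = y}"
          by (intro card_mono) auto
        have "{k'. k' < Suc k \<and> q k' = i} = insert k {k'. k' < k \<and> q k' = i}"
          by (auto simp: i_def less_Suc_eq)
        then have "card {k'. k' < Suc k \<and> q k' = i} = Suc (card {k'. k' < k \<and> q k' = i})" by simp
        \<comment> \<open>At \<open>y = i\<close> the slot count grows along with the degree. At
          \<open>y = j\<close> the degree was below \<open>D\<close>, so it is still at most
          \<open>D\<close>.\<close>
        then show ?thesis
          using d mono G3[OF w(2), of y] j(4) by (cases "y = i"; cases "y = j") auto
      qed
      moreover have "card (\<Gamma>' w) = v - 1 + Suc k"
        unfolding eq using j fin[OF w(2)] G2[OF w(2)] by simp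
      moreover have "\<Gamma>' w \<subseteq> vertex_pairs {..<v}"
        unfolding eq using G1[OF w(2)] j iv by (auto simp: vertex_pairs_def)
      ultimately show ?thesis by blast
    qed
    have bound: "(\<Sum>w\<in>I'. P ^ card ((`) x ` \<Gamma>' w \<inter> E)) \<le>
             card I' * (P ^ card ((`) x ` path_edges v \<inter> E) *
               (\<Prod>k<Suc k. if x (q k) \<in> X then 1 + P * \<Delta> / m else 1))"
      if x: "inj_on x {..<v}" and E: "finite E" "\<Union>E \<subseteq> X" "\<forall>y. edge_degree E y \<le> \<Delta>" and P: "1 \<le> P"
      for x :: "nat \<Rightarrow> 'v" and E X \<Delta> and P :: real
    proof -
      define A where "A = (if x i \<in> X then 1 + P * \<Delta> / m else 1)"
      \<comment> \<open>The new edge multiplies the weight by at most \<open>1 + P\<close> if it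
        hits \<open>E\<close> and by 1 otherwise. At most \<Delta> of the \<open>m\<close> targets
        hit, and none does if \<open>x i\<close> lies outside \<open>X\<close>; averaging gives
        \<open>A\<close>.\<close>
      have step: "(\<Sum>j\<in>J u. P ^ card ((`) x ` \<Gamma>' (j # u) \<inter> E)) \<le> P ^ card ((`) x ` \<Gamma> u \<inter> E) * (m * A)"
        if u: "u \<in> I" for u
      proof -
        have ix: "inj_on x (J u)" using x J[OF u] by (auto intro: inj_on_subset)
        have hit: "card {j \<in> J u. {x i, x j} \<in> E} \<le> (if x i \<in> X then \<Delta> else 0)"
        proof (cases "x i \<in> X")
          case True
          have ne: "x j \<noteq> x i" if "j \<in> J u" for j
            using that J[OF u] iv x by (auto dest: inj_onD)
          have "card {j \<in> J u. {x i, x j} \<in> E} \<le> card {y \<in> x ` J u. y \<noteq> x i \<and> {x i, y} \<in> E}"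
            using ix ne finJ[OF u] by (intro card_inj_on_le[where f = x]) (auto intro: inj_on_subset)
          also have "\<dots> \<le> edge_degree E (x i)" by (rule card_neighbours_le_edge_degree[OF E(1)])
          also have "\<dots> \<le> \<Delta>" using E by simp
          finally show ?thesis using True by simp
        next
          case False
          then have empty: "{j \<in> J u. {x i, x j} \<in> E} = {}" using E(2) by auto
          show ?thesis unfolding empty by simp
        qed
        have "(\<Sum>j\<in>J u. P ^ card ((`) x ` \<Gamma>' (j # u) \<inter> E)) \<le>
              (\<Sum>j\<in>J u. P ^ card ((`) x ` \<Gamma> u \<inter> E) * (1 + (if {x i, x j} \<in> E then P else 0)))"
        proof (rule sum_mono)
          fix j assume "j \<in> J u"
          have e: "(`) x ` \<Gamma>' (j # u) \<inter> E =
              (if {x i, x j} \<in> E then insert {x i, x j} ((`) x ` \<Gamma> u \<inter> E) else (`) x ` \<Gamma> u \<inter> E)"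
            by (auto simp: \<Gamma>'_def)
          show "P ^ card ((`) x ` \<Gamma>' (j # u) \<inter> E) \<le>
             P ^ card ((`) x ` \<Gamma> u \<inter> E) * (1 + (if {x i, x j} \<in> E then P else 0))"
          proof (cases "{x i, x j} \<in> E")
            case True
            have "card ((`) x ` \<Gamma>' (j # u) \<inter> E) \<le> Suc (card ((`) x ` \<Gamma> u \<inter> E))"
              unfolding e using True E(1) by (simp add: card_insert_if)
            then have "P ^ card ((`) x ` \<Gamma>' (j # u) \<inter> E) \<le> P ^ Suc (card ((`) x ` \<Gamma> u \<inter> E))"
              using P by (rule power_increasing)
            also have "\<dots> \<le> P ^ card ((`) x ` \<Gamma> u \<inter> E) * (1 + P)"
              using P by (simp add: algebra_simps)
            finally show ?thesis using True by simp
          qed (simp add: e)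
        qed
        also have "\<dots> = P ^ card ((`) x ` \<Gamma> u \<inter> E) * (m + P * card {j \<in> J u. {x i, x j} \<in> E})"
          using finJ[OF u] Jm[OF u]
          by (simp add: sum.distrib sum.If_cases Int_def flip: sum_distrib_left)
        also have "\<dots> \<le> P ^ card ((`) x ` \<Gamma> u \<inter> E) * (m + P * (if x i \<in> X then \<Delta> else 0))"
          using P hit by (intro mult_left_mono add_left_mono) (auto simp: of_nat_mono split: if_splits)
        also have "m + P * (if x i \<in> X then \<Delta> else 0) = m * A"
          using \<open>m > 0\<close> by (simp add: A_def field_simps)
        finally show ?thesis .
      qed
      have "A \<ge> 0" using P by (simp add: A_def)
      have "(\<Sum>w\<in>I'. P ^ card ((`) x ` \<Gamma>' w \<inter> E)) \<le> (\<Sum>u\<in>I. P ^ card ((`) x ` \<Gamma> u \<inter> E) * (m * A))"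
        unfolding sum' by (intro sum_mono step)
      also have "\<dots> = (\<Sum>u\<in>I. P ^ card ((`) x ` \<Gamma> u \<inter> E)) * (m * A)" by (simp add: sum_distrib_right)
      also have "\<dots> \<le> card I * (P ^ card ((`) x ` path_edges v \<inter> E) *
               (\<Prod>k<k. if x (q k) \<in> X then 1 + P * \<Delta> / m else 1)) * (m * A)"
        using G4[OF x E P] \<open>A \<ge> 0\<close> by (intro mult_right_mono) auto
      also have "\<dots> = card I' * (P ^ card ((`) x ` path_edges v \<inter> E) *
               (\<Prod>k<Suc k. if x (q k) \<in> X then 1 + P * \<Delta> / m else 1))"
        unfolding \<open>card I' = card I * m\<close> by (simp add: A_def i_def)
      finally show ?thesis .
    qed
    show ?case unfolding good_def
      using \<open>finite I'\<close> \<open>I' \<noteq> {}\<close> step_props bound by (intro exI[of _ I'] exI[of _ \<Gamma>']) auto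
  qed
  then obtain I \<Gamma> where IG: "good K I \<Gamma>" by blast
  have deg: "edge_degree (\<Gamma> u) i \<le> D + R" if "u \<in> I" for u i
  proof -
    have "edge_degree (\<Gamma> u) i \<le> D + card {k'. k' < K \<and> q k' = i}"
      using IG that unfolding good_def by blast
    then show ?thesis using R[of i] by linarith
  qed
  show ?thesis
    by (rule that[of I \<Gamma>]) (use IG deg in \<open>unfold good_def, blast+\<close>)
qed

subsection \<open>Weighted walks\<close>

lemma sum_PiE_lessThan_Suc:
  fixes f :: "(nat \<Rightarrow> 'v) \<Rightarrow> real"
  shows "(\<Sum>x\<in>{..<Suc k} \<rightarrow>\<^sub>E V. f x) = (\<Sum>y\<in>V. \<Sum>x\<in>{..<k} \<rightarrow>\<^sub>E V. f (x(k := y)))"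
proof -
  have "(\<Sum>x\<in>{..<Suc k} \<rightarrow>\<^sub>E V. f x) = (\<Sum>(y, x)\<in>V \<times> ({..<k} \<rightarrow>\<^sub>E V). f (x(k := y)))"
    unfolding lessThan_Suc PiE_insert_eq
    by (subst sum.reindex[OF inj_combinator]) (auto simp: split_beta)
  then show ?thesis by (simp add: sum.cartesian_product)
qed

text \<open>A product form of the overlap weight that can be summed vertex by vertex:
  \<open>c i\<close> will collect the slots owned by path vertex \<open>i\<close>, and
  \<open>P\<close> is paid for every path step along an edge of \<open>E\<close>. The walk
  \<open>x\<close> need not be injective.\<close>

definition walk_weight ::
  "(nat \<Rightarrow> real) \<Rightarrow> real \<Rightarrow> 'v set \<Rightarrow> 'v set set \<Rightarrow> nat \<Rightarrow> (nat \<Rightarrow> 'v) \<Rightarrow> real" where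
  "walk_weight c P X E k x =
     (\<Prod>i<k. if x i \<in> X then c i else 1) * (\<Prod>i<k - 1. if {x i, x (Suc i)} \<in> E then P else 1)"

lemma walk_weight_Suc:
  "walk_weight c P X E (Suc k) (x(k := y)) = walk_weight c P X E k x *
     (if y \<in> X then c k else 1) * (if k > 0 \<and> {x (k - 1), y} \<in> E then P else 1)"
proof (cases k)
  case (Suc j)
  have "(\<Prod>i<Suc k. if (x(k := y)) i \<in> X then c i else 1) =
        (\<Prod>i<k. if x i \<in> X then c i else 1) * (if y \<in> X then c k else 1)"
    unfolding prod.lessThan_Suc by (intro arg_cong2[where f = times] prod.cong) auto
  moreover have "(\<Prod>i<Suc k - 1. if {(x(k := y)) i, (x(k := y)) (Suc i)} \<in> E then P else 1) =
        (\<Prod>i<k - 1. if {x i, x (Suc i)} \<in> E then P else 1) * (if {x (k - 1), y} \<in> E then P else 1)"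
    unfolding Suc diff_Suc_1 prod.lessThan_Suc by (intro arg_cong2[where f = times] prod.cong) auto
  ultimately show ?thesis unfolding walk_weight_def using Suc by simp
qed (simp add: walk_weight_def)

lemma walk_weight_nonneg:
  assumes "\<And>i. c i \<ge> 0" "P \<ge> 0"
  shows "walk_weight c P X E k x \<ge> 0"
  unfolding walk_weight_def using assms by (intro mult_nonneg_nonneg prod_nonneg) auto

text \<open>\<open>\<rho> k\<close> bounds, relative to the total weight, the weight of the walks that end in a prescribed
  vertex of \<open>X\<close>.\<close>

lemma sum_walk_weight_le:
  fixes c \<rho> :: "nat \<Rightarrow> real" and P :: real and V :: "'v set" and w \<Delta> :: nat
  assumes V: "finite V" "V \<noteq> {}" and X: "X \<subseteq> V" "card X \<le> w" and E: "\<Union>E \<subseteq> X"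
    and deg: "\<And>y. card {z \<in> V. {z, y} \<in> E} \<le> \<Delta>"
    and c: "\<And>i. c i \<ge> 0" and P: "P \<ge> 0"
    and \<rho>: "\<And>k. \<rho> k \<ge> 0" "\<And>k. c k * (1 + P * \<Delta> * \<rho> k) / card V \<le> \<rho> (Suc k)"
  shows "(\<Sum>x\<in>{..<k} \<rightarrow>\<^sub>E V. walk_weight c P X E k x) \<le> card V ^ k * (\<Prod>i<k. 1 + w * \<rho> (Suc i))"
proof -
  define n where "n = card V"
  have n: "n > 0" using V by (simp add: n_def card_gt_0_iff)
  define W where "W k = (\<Sum>x\<in>{..<k} \<rightarrow>\<^sub>E V. walk_weight c P X E k x)" for k
  \<comment> \<open>\<open>U k y\<close> is the weight of the walks whose vertex of index
    \<open>k\<close> is \<open>y\<close>, so \<open>W (Suc k)\<close> is the sum of all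
    \<open>U k y\<close>.\<close>
  define U where "U k y = (\<Sum>x\<in>{..<k} \<rightarrow>\<^sub>E V. walk_weight c P X E (Suc k) (x(k := y)))" for k y
  define \<tau> where "\<tau> k = (\<Prod>i<k. 1 + w * \<rho> (Suc i))" for k
  have wnn: "walk_weight c P X E k x \<ge> 0" for k x by (rule walk_weight_nonneg) (rule c P)+
  have \<tau>0: "\<tau> k \<ge> 0" for k unfolding \<tau>_def using \<rho>(1) by (intro prod_nonneg) auto
  have \<tau>_Suc: "\<tau> (Suc k) = \<tau> k * (1 + w * \<rho> (Suc k))" for k by (simp add: \<tau>_def)
  have \<tau>_mono: "\<tau> k \<le> \<tau> (Suc k)" for k
    unfolding \<tau>_Suc using \<tau>0[of k] \<rho>(1)[of "Suc k"] by (simp add: algebra_simps)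
  have W_Suc: "W (Suc k) = (\<Sum>y\<in>V. U k y)" for k
    unfolding W_def U_def by (rule sum_PiE_lessThan_Suc)
  \<comment> \<open>An endpoint outside \<open>X\<close> carries no factor \<open>c\<close> and
    cannot be reached along \<open>E\<close>.\<close>
  have U_out: "U k y = W k" if "y \<notin> X" for k y
  proof -
    have "{z, y} \<notin> E" for z using E that by auto
    then show ?thesis unfolding U_def W_def walk_weight_Suc using that by simp
  qed
  have U_in0: "U 0 y \<le> c 0 * W 0" if "y \<in> X" for y
    unfolding U_def W_def walk_weight_Suc using that by simp
  \<comment> \<open>Either the last step avoids \<open>E\<close>, which is bounded by the whole of
    \<open>W\<close>, or it comes from an \<open>E\<close>-neighbour of \<open>y\<close> and costs a
    factor \<open>P\<close>.\<close>
  have U_in: "U (Suc k) y \<le> c (Suc k) * (W (Suc k) + P * (\<Sum>z\<in>{z \<in> V. {z, y} \<in> E}. U k z))"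
    if "y \<in> X" for k y
  proof -
    have "U (Suc k) y = (\<Sum>x\<in>{..<Suc k} \<rightarrow>\<^sub>E V. walk_weight c P X E (Suc k) x * c (Suc k) *
        (if {x k, y} \<in> E then P else 1))"
      unfolding U_def walk_weight_Suc using that by simp
    also have "\<dots> \<le> (\<Sum>x\<in>{..<Suc k} \<rightarrow>\<^sub>E V. c (Suc k) * (walk_weight c P X E (Suc k) x +
        P * (if {x k, y} \<in> E then walk_weight c P X E (Suc k) x else 0)))"
    proof (rule sum_mono)
      fix x
      have "walk_weight c P X E (Suc k) x * (if {x k, y} \<in> E then P else 1) \<le> walk_weight c P X E (Suc k) x +
        P * (if {x k, y} \<in> E then walk_weight c P X E (Suc k) x else 0)"
        using wnn[of "Suc k" x] by (simp add: mult.commute)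
      from mult_left_mono[OF this c[of "Suc k"]]
      show "walk_weight c P X E (Suc k) x * c (Suc k) * (if {x k, y} \<in> E then P else 1) \<le>
         c (Suc k) * (walk_weight c P X E (Suc k) x +
        P * (if {x k, y} \<in> E then walk_weight c P X E (Suc k) x else 0))"
        by (simp only: mult_ac)
    qed
    also have "\<dots> = c (Suc k) * (W (Suc k) + P * (\<Sum>x\<in>{..<Suc k} \<rightarrow>\<^sub>E V.
        if {x k, y} \<in> E then walk_weight c P X E (Suc k) x else 0))"
      unfolding W_def by (simp add: sum.distrib flip: sum_distrib_left)
    also have "(\<Sum>x\<in>{..<Suc k} \<rightarrow>\<^sub>E V. if {x k, y} \<in> E then walk_weight c P X E (Suc k) x else 0) =
      (\<Sum>z\<in>V. if {z, y} \<in> E then U k z else 0)"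
      unfolding sum_PiE_lessThan_Suc U_def by (intro sum.cong) auto
    also have "\<dots> = (\<Sum>z\<in>{z \<in> V. {z, y} \<in> E}. U k z)"
      using V by (simp add: sum.inter_filter)
    finally show ?thesis .
  qed
  \<comment> \<open>Both bounds are proved together: \<open>W\<close> grows by the walks ending in
    \<open>X\<close>, and those are controlled by \<open>W\<close> and by the previous
    \<open>U\<close>.\<close>
  have "W k \<le> n ^ k * \<tau> k \<and> (\<forall>y\<in>X. U k y \<le> n ^ Suc k * (\<tau> k * \<rho> (Suc k)))" for k
  proof (induction k)
    case 0
    have W0: "W 0 = 1" by (simp add: W_def walk_weight_def)
    have "c 0 \<le> c 0 * (1 + P * \<Delta> * \<rho> 0)"
      using c[of 0] P \<rho>(1)[of 0] by (simp add: algebra_simps)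
    then have "c 0 / n \<le> c 0 * (1 + P * \<Delta> * \<rho> 0) / n" by (rule divide_right_mono) simp
    also have "\<dots> \<le> \<rho> (Suc 0)" using \<rho>(2)[of 0] by (simp add: n_def)
    finally have "c 0 \<le> n * \<rho> (Suc 0)" using n by (simp add: field_simps)
    then show ?case using U_in0 W0 by (force simp: \<tau>_def)
  next
    case (Suc k)
    have "W (Suc k) = (\<Sum>y\<in>V - X. U k y) + (\<Sum>y\<in>X. U k y)"
      unfolding W_Suc using V X by (simp add: sum.subset_diff)
    also have "(\<Sum>y\<in>V - X. U k y) \<le> n * W k"
    proof -
      have "(\<Sum>y\<in>V - X. U k y) = card (V - X) * W k" by (simp add: U_out)
      also have "\<dots> \<le> n * W k"
        unfolding n_def using V wnn by (intro mult_right_mono) (auto simp: W_def card_mono intro: sum_nonneg)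
      finally show ?thesis .
    qed
    also have "n * W k \<le> n * (n ^ k * \<tau> k)" using Suc by (intro mult_left_mono) auto
    also have "(\<Sum>y\<in>X. U k y) \<le> (\<Sum>y\<in>X. n ^ Suc k * (\<tau> k * \<rho> (Suc k)))"
      using Suc by (intro sum_mono) auto
    also have "\<dots> = card X * (n ^ Suc k * (\<tau> k * \<rho> (Suc k)))" by simp
    also have "\<dots> \<le> w * (n ^ Suc k * (\<tau> k * \<rho> (Suc k)))"
      using X \<tau>0 \<rho>(1) by (intro mult_right_mono) auto
    finally have W: "W (Suc k) \<le> n ^ Suc k * \<tau> (Suc k)"
      by (simp add: \<tau>_Suc algebra_simps)
    have "U (Suc k) y \<le> n ^ Suc (Suc k) * (\<tau> (Suc k) * \<rho> (Suc (Suc k)))" if y: "y \<in> X" for y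
    proof -
      \<comment> \<open>All \<open>E\<close>-neighbours lie in \<open>X\<close>, so the induction
        hypothesis covers every \<open>U k z\<close> that occurs.\<close>
      have sub: "{z \<in> V. {z, y} \<in> E} \<subseteq> X" using E by auto
      have "(\<Sum>z\<in>{z \<in> V. {z, y} \<in> E}. U k z) \<le> (\<Sum>z\<in>{z \<in> V. {z, y} \<in> E}. n ^ Suc k * (\<tau> k * \<rho> (Suc k)))"
        using Suc sub by (intro sum_mono) auto
      also have "\<dots> = card {z \<in> V. {z, y} \<in> E} * (n ^ Suc k * (\<tau> k * \<rho> (Suc k)))" by simp
      also have "\<dots> \<le> \<Delta> * (n ^ Suc k * (\<tau> k * \<rho> (Suc k)))"
        using deg[of y] \<tau>0 \<rho>(1) by (intro mult_right_mono) auto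
      also have "\<dots> \<le> \<Delta> * (n ^ Suc k * (\<tau> (Suc k) * \<rho> (Suc k)))"
        using \<tau>_mono \<rho>(1) by (intro mult_left_mono mult_right_mono) auto
      finally have "c (Suc k) * (W (Suc k) + P * (\<Sum>z\<in>{z \<in> V. {z, y} \<in> E}. U k z)) \<le>
         c (Suc k) * (n ^ Suc k * \<tau> (Suc k) + P * (\<Delta> * (n ^ Suc k * (\<tau> (Suc k) * \<rho> (Suc k)))))"
        using W c P by (intro mult_left_mono add_mono) auto
      also have "\<dots> = n ^ Suc (Suc k) * \<tau> (Suc k) * (c (Suc k) * (1 + P * \<Delta> * \<rho> (Suc k)) / n)"
        using n by (simp add: field_simps)
      also have "\<dots> \<le> n ^ Suc (Suc k) * \<tau> (Suc k) * \<rho> (Suc (Suc k))"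
        using \<rho>(2)[of "Suc k"] \<tau>0 by (intro mult_left_mono) (auto simp: n_def)
      finally show ?thesis using U_in[OF y, of k] by (simp add: mult.assoc)
    qed
    with W show ?case by blast
  qed
  then show ?thesis by (simp add: W_def \<tau>_def n_def)
qed

subsection \<open>Copies in random graphs\<close>

text \<open>By independence of the pairs: the event is a box whose coordinates in \<open>F\<close>
  are forced and whose other coordinates are free.\<close>

lemma prob_edges_subset:
  assumes "F \<subseteq> vertex_pairs {1..n}" "0 \<le> p" "p \<le> 1"
  shows "measure_pmf.prob (random_graph n p) {G. F \<subseteq> snd G} = p ^ card F"
proof -
  have fin: "finite (vertex_pairs {1..n})" by (rule finite_vertex_pairs) simp
  define B where "B e = (if e \<in> F then {True} else UNIV)" for e
  have "measure_pmf.prob (random_graph n p) {G. F \<subseteq> snd G} =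
      measure_pmf.prob (Pi_pmf (vertex_pairs {1..n}) False (\<lambda>_. bernoulli_pmf p)) (Pi (vertex_pairs {1..n}) B)"
    unfolding random_graph_def measure_map_pmf using assms(1)
    by (intro arg_cong2[where f = measure]) (auto simp: B_def Pi_def)
  also have "\<dots> = (\<Prod>e\<in>vertex_pairs {1..n}. measure_pmf.prob (bernoulli_pmf p) (B e))"
    by (rule measure_Pi_pmf_Pi[OF fin])
  also have "\<dots> = (\<Prod>e\<in>vertex_pairs {1..n}. if e \<in> F then p else 1)"
    using assms by (intro prod.cong) (auto simp: B_def measure_pmf_single)
  also have "\<dots> = p ^ card F"
    using fin assms(1) by (simp add: prod.If_cases Int_absorb1 flip: Int_def)
  finally show ?thesis .
qed

lemma fst_random_graph: "G \<in> set_pmf (random_graph n p) \<Longrightarrow> fst G = {1..n}"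
  by (auto simp: random_graph_def)

text \<open>Chebyshev's inequality for the number \<open>N\<close> of events that occur. The
  assumption on pairs bounds the variance by \<open>\<eta> * \<mu>\<^sup>2\<close>, and
  \<open>(N x - \<mu>)\<^sup>2\<close> equals \<open>\<mu>\<^sup>2\<close> wherever no event
  occurs.\<close>

lemma second_moment:
  fixes M :: "'a pmf" and A :: "'i \<Rightarrow> 'a set"
  assumes \<Omega>: "finite \<Omega>" "\<Omega> \<noteq> {}" and q: "q > 0" "\<And>i. i \<in> \<Omega> \<Longrightarrow> measure_pmf.prob M (A i) = q"
    and pairs: "(\<Sum>i\<in>\<Omega>. \<Sum>j\<in>\<Omega>. measure_pmf.prob M (A i \<inter> A j)) \<le> (1 + \<eta>) * (q * card \<Omega>)\<^sup>2"
  shows "measure_pmf.prob M {x. \<forall>i\<in>\<Omega>. x \<notin> A i} \<le> \<eta>"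
proof -
  define \<mu> where "\<mu> = q * card \<Omega>"
  define N where "N x = (\<Sum>i\<in>\<Omega>. indicator (A i) x :: real)" for x
  have \<mu>: "\<mu> > 0" using \<Omega> q by (simp add: \<mu>_def card_gt_0_iff)
  have int[simp]: "integrable (measure_pmf M) (indicator B :: 'a \<Rightarrow> real)" for B
    by (rule measure_pmf.integrable_const_bound[of _ 1]) auto
  have NN: "(N x)\<^sup>2 = (\<Sum>i\<in>\<Omega>. \<Sum>j\<in>\<Omega>. indicator (A i \<inter> A j) x)" for x
    by (simp add: N_def power2_eq_square sum_product indicator_inter_arith)
  have intN: "integrable (measure_pmf M) N" unfolding N_def by (intro Bochner_Integration.integrable_sum int)
  have intNN: "integrable (measure_pmf M) (\<lambda>x. (N x)\<^sup>2)"
    unfolding NN by (intro Bochner_Integration.integrable_sum int)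
  have EN: "measure_pmf.expectation M N = \<mu>"
    unfolding N_def using q(2) by (simp add: \<mu>_def)
  have ENN: "measure_pmf.expectation M (\<lambda>x. (N x)\<^sup>2) \<le> (1 + \<eta>) * \<mu>\<^sup>2"
    unfolding NN using pairs by (simp add: \<mu>_def)
  have sq: "(N x - \<mu>)\<^sup>2 = (N x)\<^sup>2 - 2 * \<mu> * N x + \<mu>\<^sup>2" for x by (simp add: power2_diff)
  have "\<mu>\<^sup>2 * measure_pmf.prob M {x. \<forall>i\<in>\<Omega>. x \<notin> A i} =
      measure_pmf.expectation M (\<lambda>x. \<mu>\<^sup>2 * indicator {x. \<forall>i\<in>\<Omega>. x \<notin> A i} x)" by simp
  also have "\<dots> \<le> measure_pmf.expectation M (\<lambda>x. (N x - \<mu>)\<^sup>2)"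
  proof (rule integral_mono)
    show "integrable (measure_pmf M) (\<lambda>x. (N x - \<mu>)\<^sup>2)"
      unfolding sq using intN intNN by simp
    show "\<mu>\<^sup>2 * indicator {x. \<forall>i\<in>\<Omega>. x \<notin> A i} x \<le> (N x - \<mu>)\<^sup>2" for x
      by (auto simp: N_def indicator_def)
  qed (simp add: int)
  also have "\<dots> = measure_pmf.expectation M (\<lambda>x. (N x)\<^sup>2) - 2 * \<mu> * \<mu> + \<mu>\<^sup>2"
    unfolding sq using intN intNN EN by simp
  also have "\<dots> \<le> \<mu>\<^sup>2 * \<eta>" using ENN by (simp add: algebra_simps power2_eq_square)
  finally show ?thesis using \<mu> by simp
qed

text \<open>Fubini: a bound that holds for every fixed first component survives averaging. It allows
  the relation \<open>Q\<close> to use a shape that was selected by looking at the first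
  graph.\<close>

lemma prob_pair_pmf_le:
  assumes "\<And>x. x \<in> set_pmf M \<Longrightarrow> measure_pmf.prob N {y. Q x y} \<le> \<delta>" "\<delta> \<ge> 0"
  shows "measure_pmf.prob (pair_pmf M N) {(x, y). Q x y} \<le> \<delta>"
proof -
  have "emeasure (measure_pmf (pair_pmf M N)) {(x, y). Q x y} =
      (\<integral>\<^sup>+z. indicator {(x, y). Q x y} z \<partial>measure_pmf (pair_pmf M N))" by simp
  also have "\<dots> = (\<integral>\<^sup>+x. \<integral>\<^sup>+y. indicator {(x, y). Q x y} (x, y) \<partial>N \<partial>M)"
    by (rule nn_integral_pair_pmf')
  also have "\<dots> = (\<integral>\<^sup>+x. emeasure N {y. Q x y} \<partial>M)"
  proof (rule nn_integral_cong)
    fix x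
    have "(\<integral>\<^sup>+y. indicator {(x, y). Q x y} (x, y) \<partial>N) = (\<integral>\<^sup>+y. indicator {y. Q x y} y \<partial>N)"
      by (intro nn_integral_cong) (simp add: indicator_def)
    then show "(\<integral>\<^sup>+y. indicator {(x, y). Q x y} (x, y) \<partial>N) = emeasure N {y. Q x y}" by simp
  qed
  also have "\<dots> \<le> (\<integral>\<^sup>+x. ennreal \<delta> \<partial>M)"
    using assms by (intro nn_integral_mono_AE)
      (auto simp: AE_measure_pmf_iff measure_pmf.emeasure_eq_measure intro!: ennreal_leI)
  also have "\<dots> = ennreal \<delta>" by simp
  finally show ?thesis using assms(2) by (simp add: measure_pmf.emeasure_eq_measure)
qed

section \<open>Injective placements of a shape\<close>

lemma image_vertex_pairs:
  assumes "inj_on x V" "H \<subseteq> vertex_pairs V" "x ` V \<subseteq> W"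
  shows "(`) x ` H \<subseteq> vertex_pairs W"
proof (clarify)
  fix e assume "e \<in> H"
  then have "e \<subseteq> V" "card e = 2" using assms(2) by (auto simp: vertex_pairs_def)
  then show "x ` e \<in> vertex_pairs W"
    using assms(1,3) card_image[OF inj_on_subset[OF assms(1)], of e] by (auto simp: vertex_pairs_def)
qed

lemma card_image_edges:
  assumes "inj_on x V" "H \<subseteq> vertex_pairs V"
  shows "card ((`) x ` H) = card H"
proof (rule card_image)
  have "H \<subseteq> Pow V" using assms(2) by (auto simp: vertex_pairs_def)
  then show "inj_on ((`) x) H" using inj_on_image_Pow[OF assms(1)] inj_on_subset by blast
qed

lemma edge_degree_image:
  assumes x: "inj_on x V" and H: "H \<subseteq> vertex_pairs V" "finite V" and deg: "\<And>i. edge_degree H i \<le> \<Delta>"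
  shows "edge_degree ((`) x ` H) y \<le> \<Delta>"
proof (cases "y \<in> x ` V")
  case True
  then obtain i where i: "i \<in> V" "y = x i" by auto
  have fin: "finite H" using H finite_vertex_pairs finite_subset by blast
  have "{e \<in> (`) x ` H. y \<in> e} \<subseteq> (`) x ` {e \<in> H. i \<in> e}"
  proof
    fix e assume "e \<in> {e \<in> (`) x ` H. y \<in> e}"
    then obtain e' where e': "e' \<in> H" "e = x ` e'" "x i \<in> x ` e'" using i by auto
    then have "i \<in> e'" using inj_on_image_mem_iff[OF x i(1), of e'] H(1) by (auto simp: vertex_pairs_def)
    then show "e \<in> (`) x ` {e \<in> H. i \<in> e}" using e' by auto
  qed
  then have "edge_degree ((`) x ` H) y \<le> card ((`) x ` {e \<in> H. i \<in> e})"
    unfolding edge_degree_def using fin by (intro card_mono) auto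
  also have "\<dots> \<le> edge_degree H i" unfolding edge_degree_def using fin by (intro card_image_le) auto
  finally show ?thesis using deg[of i] by linarith
next
  case False
  then have "{e \<in> (`) x ` H. y \<in> e} = {}" using H(1) by (auto simp: vertex_pairs_def)
  then show ?thesis by (simp only: edge_degree_def card.empty le0)
qed

text \<open>Union bound over the injective placements of \<open>H\<close>, of which there are at
  most \<open>n ^ v\<close>.\<close>

lemma prob_contains_copy_le:
  assumes H: "H \<subseteq> vertex_pairs {..<v}" and p: "0 \<le> p" "p \<le> 1"
  shows "measure_pmf.prob (random_graph n p) {G. contains_copy v H G} \<le> real n ^ v * p ^ card H"
proof -
  define X where "X = {x \<in> {..<v} \<rightarrow>\<^sub>E {1..n}. inj_on x {..<v}}"
  have finX: "finite X" unfolding X_def by (intro finite_subset[OF _ finite_PiE[of "{..<v}" "\<lambda>_. {1..n}"]]) auto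
  have "card X \<le> card ({..<v} \<rightarrow>\<^sub>E {1..n})"
    unfolding X_def by (intro card_mono finite_PiE) auto
  then have cX: "card X \<le> n ^ v" by (simp add: card_funcsetE)
  have "measure_pmf.prob (random_graph n p) {G. contains_copy v H G} =
     measure_pmf.prob (random_graph n p) ({G. contains_copy v H G} \<inter> set_pmf (random_graph n p))"
    by (simp add: measure_Int_set_pmf)
  also have "\<dots> \<le> measure_pmf.prob (random_graph n p) (\<Union>x\<in>X. {G. (`) x ` H \<subseteq> snd G})"
  proof (rule measure_pmf.finite_measure_mono)
    show "{G. contains_copy v H G} \<inter> set_pmf (random_graph n p) \<subseteq> (\<Union>x\<in>X. {G. (`) x ` H \<subseteq> snd G})"
    proof
      fix G assume G: "G \<in> {G. contains_copy v H G} \<inter> set_pmf (random_graph n p)"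
      then obtain x where x: "x ` {..<v} \<subseteq> {1..n}" "inj_on x {..<v}" "(`) x ` H \<subseteq> snd G"
        using fst_random_graph[of G n p] by (auto simp: contains_copy_def)
      \<comment> \<open>Restricting \<open>x\<close> puts it into the extensional function space,
        which is finite, without changing the images of edges.\<close>
      have eq: "restrict x {..<v} ` e = x ` e" if "e \<in> H" for e
        using that H by (intro image_cong) (auto simp: vertex_pairs_def)
      have "restrict x {..<v} \<in> X" using x by (auto simp: X_def inj_on_restrict_eq)
      moreover have "(`) (restrict x {..<v}) ` H \<subseteq> snd G"
        using x(3) eq by auto
      ultimately show "G \<in> (\<Union>x\<in>X. {G. (`) x ` H \<subseteq> snd G})" by blast
    qed
  qed simp
  also have "\<dots> \<le> (\<Sum>x\<in>X. measure_pmf.prob (random_graph n p) {G. (`) x ` H \<subseteq> snd G})"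
    by (intro measure_pmf.finite_measure_subadditive_finite finX) auto
  also have "\<dots> = (\<Sum>x\<in>X. p ^ card H)"
  proof (rule sum.cong[OF refl])
    fix x assume "x \<in> X"
    then have "inj_on x {..<v}" "x ` {..<v} \<subseteq> {1..n}" by (auto simp: X_def)
    then show "measure_pmf.prob (random_graph n p) {G. (`) x ` H \<subseteq> snd G} = p ^ card H"
      using prob_edges_subset[OF image_vertex_pairs p] card_image_edges H by metis
  qed
  also have "\<dots> \<le> real n ^ v * p ^ card H"
    using cX p by (auto intro!: mult_right_mono simp flip: of_nat_power)
  finally show ?thesis .
qed

text \<open>Slots are grouped by their owner \<open>q k\<close>. Every path edge mapped into
  \<open>E\<close> comes from at least one step of the walk, and extra steps only help because
  \<open>P \<ge> 1\<close>.\<close>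

lemma path_slot_weight_le_walk_weight:
  fixes P A :: real and x :: "nat \<Rightarrow> 'v" and q :: "nat \<Rightarrow> nat" and K v :: nat
  assumes P: "P \<ge> 1" and A: "A \<ge> 0" and E: "finite E" and q: "\<And>k. k < K \<Longrightarrow> q k < v"
  shows "P ^ card ((`) x ` path_edges v \<inter> E) * (\<Prod>k<K. if x (q k) \<in> X then A else 1)
    \<le> walk_weight (\<lambda>i. A ^ card {k. k < K \<and> q k = i}) P X E v x"
proof -
  have img: "(`) x ` path_edges v = (\<lambda>i. {x i, x (Suc i)}) ` {..<v - 1}"
    by (simp add: path_edges_def image_image)
  have "card ((`) x ` path_edges v \<inter> E) \<le> card ((\<lambda>i. {x i, x (Suc i)}) ` {i \<in> {..<v - 1}. {x i, x (Suc i)} \<in> E})"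
    unfolding img by (intro card_mono) auto
  also have "\<dots> \<le> card {i \<in> {..<v - 1}. {x i, x (Suc i)} \<in> E}" by (intro card_image_le) auto
  finally have "P ^ card ((`) x ` path_edges v \<inter> E) \<le> P ^ card {i \<in> {..<v - 1}. {x i, x (Suc i)} \<in> E}"
    using P by (intro power_increasing)
  also have "\<dots> = (\<Prod>i<v - 1. if {x i, x (Suc i)} \<in> E then P else 1)"
    by (simp add: prod.If_cases Int_def)
  finally have 1: "P ^ card ((`) x ` path_edges v \<inter> E) \<le> (\<Prod>i<v - 1. if {x i, x (Suc i)} \<in> E then P else 1)" .
  have "(\<Prod>k<K. if x (q k) \<in> X then A else 1) =
      (\<Prod>i<v. \<Prod>k\<in>{k \<in> {..<K}. q k = i}. if x (q k) \<in> X then A else 1)"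
    by (rule prod.group[symmetric]) (use q in auto)
  also have "\<dots> = (\<Prod>i<v. if x i \<in> X then A ^ card {k. k < K \<and> q k = i} else 1)"
    by (intro prod.cong) (auto simp: prod_constant)
  finally have 2: "(\<Prod>k<K. if x (q k) \<in> X then A else 1) = (\<Prod>i<v. if x i \<in> X then A ^ card {k. k < K \<and> q k = i} else 1)" .
  show ?thesis
    unfolding walk_weight_def 2 using mult_right_mono[OF 1, of "\<Prod>i<v. if x i \<in> X then A ^ card {k. k < K \<and> q k = i} else 1"] A
    by (simp add: mult.commute prod_nonneg)
qed

text \<open>The two error terms are the two ways to fail: \<open>\<eta>\<close> bounds the
  probability that the first graph contains no shape of the family, by the second moment, and
  \<open>real n ^ v * p ^ (v - 1 + K)\<close> bounds the probability that the shape found there also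
  occurs in the second graph. The assumption on \<open>\<rho>\<close> is the recursion of
  \<open>sum_walk_weight_le\<close>, whose factor for a path vertex is a power of \<open>A\<close>,
  one factor \<open>A\<close> per slot.\<close>

lemma prob_fo_distinguishability_le:
  fixes q :: "nat \<Rightarrow> nat" and v m D R z K n :: nat and p \<eta> :: real and \<rho> :: "nat \<Rightarrow> real"
  assumes D: "D \<ge> 2" "m > 0" and v: "z + D + R + 1 + m \<le> v" and K: "2 * (v + K) \<le> D * z"
    and q: "\<And>k. k < K \<Longrightarrow> q k < v"
    and R: "\<And>i. card {k. k < K \<and> q k = i} \<le> R"
    and p: "0 < p" "p \<le> 1" and "n \<ge> 1"
    and \<rho>: "\<And>k. \<rho> k \<ge> 0"
      "\<And>k. (1 + (D + R) / (p * m)) ^ card {k'. k' < K \<and> q k' = k} * (1 + (D + R) / p * \<rho> k) / n \<le> \<rho> (Suc k)"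
    and inj: "card {x \<in> {..<v} \<rightarrow>\<^sub>E {1..n}. inj_on x {..<v}} > 0"
    and \<eta>: "real n ^ v * (\<Prod>i<v. 1 + v * \<rho> (Suc i)) \<le> (1 + \<eta>) * card {x \<in> {..<v} \<rightarrow>\<^sub>E {1..n}. inj_on x {..<v}}"
  shows "measure_pmf.prob (pair_pmf (random_graph n p) (random_graph n p))
           {(G1, G2). \<not> fo_distinguishability G1 G2 \<le> enat v} \<le> \<eta> + real n ^ v * p ^ (v - 1 + K)"
proof -
  define \<Delta> where "\<Delta> = D + R"
  define P where "P = 1 / p"
  define A where "A = 1 + P * \<Delta> / m"
  have P: "P \<ge> 1" using p by (simp add: P_def)
  have A: "A \<ge> 0" using P by (simp add: A_def)
  define X where "X = {x \<in> {..<v} \<rightarrow>\<^sub>E {1..n}. inj_on x {..<v}}"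
  have finX: "finite X" unfolding X_def by (intro finite_subset[OF _ finite_PiE[of "{..<v}" "\<lambda>_. {1..n}"]]) auto
  obtain I :: "nat list set" and \<Gamma> :: "nat list \<Rightarrow> nat set set"
    where I: "finite I" "I \<noteq> {}"
    and G1: "\<And>u. u \<in> I \<Longrightarrow> \<Gamma> u \<subseteq> vertex_pairs {..<v}"
    and G2: "\<And>u. u \<in> I \<Longrightarrow> card (\<Gamma> u) = v - 1 + K"
    and G3: "\<And>u i. u \<in> I \<Longrightarrow> edge_degree (\<Gamma> u) i \<le> D + R"
    and G4: "\<And>(x :: nat \<Rightarrow> nat) E X \<Delta> P. inj_on x {..<v} \<Longrightarrow> finite E \<Longrightarrow> \<Union>E \<subseteq> X \<Longrightarrow>
           \<forall>y. edge_degree E y \<le> \<Delta> \<Longrightarrow> (1::real) \<le> P \<Longrightarrow>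
           (\<Sum>u\<in>I. P ^ card ((`) x ` \<Gamma> u \<inter> E)) \<le>
             card I * (P ^ card ((`) x ` path_edges v \<inter> E) *
               (\<Prod>k<K. if x (q k) \<in> X then 1 + P * \<Delta> / m else 1))"
    by (rule slot_graph_family[where ?'v = nat, OF D v K q R]) (assumption, rule that)
  define e where "e = v - 1 + K"
  define F where "F = (\<lambda>(x :: nat \<Rightarrow> nat, u). (`) x ` \<Gamma> u)"
  \<comment> \<open>The second moment counts pairs of a placement and a shape; different pairs may
    have the same edge set.\<close>
  define \<Omega> where "\<Omega> = X \<times> I"
  have \<Omega>: "finite \<Omega>" "\<Omega> \<noteq> {}"
    using finX I inj[folded X_def] by (auto simp: \<Omega>_def)
  have x: "inj_on x {..<v}" "x ` {..<v} \<subseteq> {1..n}" if "x \<in> X" for x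
    using that by (auto simp: X_def)
  have F: "F w \<subseteq> vertex_pairs {1..n}" "card (F w) = e" if "w \<in> \<Omega>" for w
    using that image_vertex_pairs[OF x(1) G1 x(2)] card_image_edges[OF x(1) G1] G2
    by (auto simp: \<Omega>_def F_def e_def)
  have finF: "finite (F w)" if "w \<in> \<Omega>" for w
    using F(1)[OF that] finite_vertex_pairs[of "{1..n}"] finite_subset by blast
  have overlap: "(\<Sum>w'\<in>\<Omega>. P ^ card (F w' \<inter> F w)) \<le> (1 + \<eta>) * card \<Omega>" if w: "w \<in> \<Omega>" for w
  proof -
    obtain y u where yu: "w = (y, u)" "y \<in> X" "u \<in> I" using w by (auto simp: \<Omega>_def)
    have deg: "edge_degree (F w) z \<le> \<Delta>" for z
      unfolding F_def yu split \<Delta>_def using edge_degree_image[OF x(1)[OF yu(2)] G1[OF yu(3)]] G3[OF yu(3)] by simp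
    have Y: "\<Union>(F w) \<subseteq> y ` {..<v}" unfolding F_def yu using G1[OF yu(3)] by (auto simp: vertex_pairs_def)
    have deg': "card {z \<in> {1..n}. {z, z'} \<in> F w} \<le> \<Delta>" for z'
    proof -
      have "{z', z'} \<notin> F w" using F(1)[OF w] by (auto simp: vertex_pairs_def)
      then have "{z \<in> {1..n}. {z, z'} \<in> F w} = {z \<in> {1..n}. z \<noteq> z' \<and> {z', z} \<in> F w}"
        by (auto simp: insert_commute)
      then show ?thesis
        using card_neighbours_le_edge_degree[OF finF[OF w], of "{1..n}" z'] deg[of z'] by simp
    qed
    have "(\<Sum>w'\<in>\<Omega>. P ^ card (F w' \<inter> F w)) = (\<Sum>x\<in>X. \<Sum>u\<in>I. P ^ card ((`) x ` \<Gamma> u \<inter> F w))"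
      unfolding \<Omega>_def sum.cartesian_product by (simp add: F_def split_beta)
    also have "\<dots> \<le> (\<Sum>x\<in>X. card I * walk_weight (\<lambda>i. A ^ card {k. k < K \<and> q k = i}) P (y ` {..<v}) (F w) v x)"
    proof (rule sum_mono)
      fix x' assume x': "x' \<in> X"
      have "(\<Sum>u\<in>I. P ^ card ((`) x' ` \<Gamma> u \<inter> F w)) \<le> card I * (P ^ card ((`) x' ` path_edges v \<inter> F w) *
               (\<Prod>k<K. if x' (q k) \<in> y ` {..<v} then 1 + P * \<Delta> / m else 1))"
        by (rule G4[OF x(1)[OF x'] finF[OF w] Y _ P]) (simp add: deg)
      also have "\<dots> \<le> card I * walk_weight (\<lambda>i. A ^ card {k. k < K \<and> q k = i}) P (y ` {..<v}) (F w) v x'"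
        unfolding A_def[symmetric]
        by (intro mult_left_mono path_slot_weight_le_walk_weight P A finF w q) auto
      finally show "(\<Sum>u\<in>I. P ^ card ((`) x' ` \<Gamma> u \<inter> F w)) \<le>
         card I * walk_weight (\<lambda>i. A ^ card {k. k < K \<and> q k = i}) P (y ` {..<v}) (F w) v x'" .
    qed
    \<comment> \<open>Injectivity is dropped here: the weights are nonnegative, and the sum over all
      maps factors along the walk. The assumption on \<eta> later turns \<open>n ^ v\<close> back
      into the number of injections.\<close>
    also have "\<dots> \<le> (\<Sum>x\<in>{..<v} \<rightarrow>\<^sub>E {1..n}. card I * walk_weight (\<lambda>i. A ^ card {k. k < K \<and> q k = i}) P (y ` {..<v}) (F w) v x)"
      using A P by (intro sum_mono2 finite_PiE mult_nonneg_nonneg walk_weight_nonneg) (auto simp: X_def)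
    also have "\<dots> = card I * (\<Sum>x\<in>{..<v} \<rightarrow>\<^sub>E {1..n}. walk_weight (\<lambda>i. A ^ card {k. k < K \<and> q k = i}) P (y ` {..<v}) (F w) v x)"
      by (simp add: sum_distrib_left)
    also have "\<dots> \<le> card I * (card {1..n} ^ v * (\<Prod>i<v. 1 + v * \<rho> (Suc i)))"
    proof (intro mult_left_mono sum_walk_weight_le)
      show "card (y ` {..<v}) \<le> v" using card_image_le[of "{..<v}" y] by simp
      show "A ^ card {k'. k' < K \<and> q k' = k} * (1 + P * \<Delta> * \<rho> k) / card {1..n} \<le> \<rho> (Suc k)" for k
        using \<rho>(2)[of k] by (simp add: A_def P_def \<Delta>_def field_simps)
    qed (use A P \<rho> \<open>n \<ge> 1\<close> Y deg' x(2)[OF yu(2)] in auto)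
    also have "\<dots> \<le> card I * ((1 + \<eta>) * card X)"
      using \<eta> by (intro mult_left_mono) (auto simp: X_def)
    finally show ?thesis by (simp add: \<Omega>_def card_cartesian_product mult_ac)
  qed
  define A' where "A' w = {G :: nat graph. F w \<subseteq> snd G}" for w
  have bad1: "measure_pmf.prob (random_graph n p) {G. \<forall>w\<in>\<Omega>. G \<notin> A' w} \<le> \<eta>"
  proof (rule second_moment[OF \<Omega>])
    show "p ^ e > 0" using p by simp
    show "measure_pmf.prob (random_graph n p) (A' w) = p ^ e" if "w \<in> \<Omega>" for w
      unfolding A'_def using prob_edges_subset[OF F(1)[OF that], of p] F(2)[OF that] p by simp
    have "measure_pmf.prob (random_graph n p) (A' w \<inter> A' w') = (p ^ e)\<^sup>2 * P ^ card (F w' \<inter> F w)"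
      if w: "w \<in> \<Omega>" and w': "w' \<in> \<Omega>" for w w'
    proof -
      have eq: "A' w \<inter> A' w' = {G. F w \<union> F w' \<subseteq> snd G}" by (auto simp: A'_def)
      have "measure_pmf.prob (random_graph n p) (A' w \<inter> A' w') = p ^ card (F w \<union> F w')"
        unfolding eq using F(1)[OF w] F(1)[OF w'] p by (intro prob_edges_subset) auto
      \<comment> \<open>Two placed shapes share \<open>card (F w' \<inter> F w)\<close> edges, so
        their joint probability exceeds the product of the single ones by the power of
        \<open>P\<close> estimated in \<open>overlap\<close>.\<close>
      moreover have "card (F w \<union> F w') + card (F w' \<inter> F w) = 2 * e"
        using card_Un_Int[OF finF[OF w] finF[OF w']] F(2)[OF w] F(2)[OF w'] by (simp add: Int_commute)
      then have "p ^ card (F w \<union> F w') * p ^ card (F w' \<inter> F w) = (p ^ e)\<^sup>2"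
        by (metis power_add power_mult mult.commute)
      ultimately show ?thesis using p by (simp add: P_def power_one_over field_simps)
    qed
    then have "(\<Sum>w\<in>\<Omega>. \<Sum>w'\<in>\<Omega>. measure_pmf.prob (random_graph n p) (A' w \<inter> A' w')) =
        (\<Sum>w\<in>\<Omega>. (p ^ e)\<^sup>2 * (\<Sum>w'\<in>\<Omega>. P ^ card (F w' \<inter> F w)))"
      by (simp add: sum_distrib_left)
    also have "\<dots> \<le> (\<Sum>w\<in>\<Omega>. (p ^ e)\<^sup>2 * ((1 + \<eta>) * card \<Omega>))"
      by (intro sum_mono mult_left_mono overlap) auto
    also have "\<dots> = (1 + \<eta>) * (p ^ e * card \<Omega>)\<^sup>2" by (simp add: power2_eq_square mult_ac)
    finally show "(\<Sum>w\<in>\<Omega>. \<Sum>w'\<in>\<Omega>. measure_pmf.prob (random_graph n p) (A' w \<inter> A' w')) \<le>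
      (1 + \<eta>) * (p ^ e * card \<Omega>)\<^sup>2" .
  qed
  \<comment> \<open>The chosen placed shape depends on the first graph alone, so it is fixed once
    that graph is given and is independent of the second.\<close>
  define w where "w G = (SOME w. w \<in> \<Omega> \<and> G \<in> A' w)" for G
  have wG: "w G \<in> \<Omega>" "G \<in> A' (w G)" if "\<not> (\<forall>w\<in>\<Omega>. G \<notin> A' w)" for G
    using someI_ex[of "\<lambda>w. w \<in> \<Omega> \<and> G \<in> A' w"] that unfolding w_def by blast+
  define M where "M = pair_pmf (random_graph n p) (random_graph n p)"
  define Q where "Q G G' \<longleftrightarrow> \<not> (\<forall>w\<in>\<Omega>. G \<notin> A' w) \<and> contains_copy v (\<Gamma> (snd (w G))) G'" for G and G' :: "nat graph"
  have bad2: "measure_pmf.prob M {(G, G'). Q G G'} \<le> real n ^ v * p ^ e"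
    unfolding M_def
  proof (rule prob_pair_pmf_le)
    fix G
    show "measure_pmf.prob (random_graph n p) {G'. Q G G'} \<le> real n ^ v * p ^ e"
    proof (cases "\<forall>w\<in>\<Omega>. G \<notin> A' w")
      case False
      then have u: "snd (w G) \<in> I" using wG(1)[OF False] by (auto simp: \<Omega>_def)
      have "{G'. Q G G'} = {G'. contains_copy v (\<Gamma> (snd (w G))) G'}" using False by (simp add: Q_def)
      then show ?thesis using prob_contains_copy_le[OF G1[OF u], of p n] G2[OF u] p by (simp add: e_def)
    qed (use p in \<open>simp add: Q_def\<close>)
  qed (use p in simp)
  have "measure_pmf.prob M {(G1, G2). \<not> fo_distinguishability G1 G2 \<le> enat v} =
     measure_pmf.prob M ({(G1, G2). \<not> fo_distinguishability G1 G2 \<le> enat v} \<inter> set_pmf M)"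
    by (simp add: measure_Int_set_pmf)
  \<comment> \<open>Outside both bad events the shape of \<open>w G\<close> occurs in the first
    graph and not in the second, so its copy sentence of depth \<open>v\<close> separates
    them.\<close>
  also have "\<dots> \<le> measure_pmf.prob M (fst -` {G. \<forall>w\<in>\<Omega>. G \<notin> A' w} \<union> {(G, G'). Q G G'})"
  proof (rule measure_pmf.finite_measure_mono, rule subsetI, rule ccontr)
    fix GG assume GG: "GG \<in> {(G1, G2). \<not> fo_distinguishability G1 G2 \<le> enat v} \<inter> set_pmf M"
      and no: "GG \<notin> fst -` {G. \<forall>w\<in>\<Omega>. G \<notin> A' w} \<union> {(G, G'). Q G G'}"
    obtain G G' where eq: "GG = (G, G')" by (cases GG)
    have ne: "\<not> (\<forall>w\<in>\<Omega>. G \<notin> A' w)" and nc: "\<not> contains_copy v (\<Gamma> (snd (w G))) G'"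
      using no by (auto simp: eq Q_def)
    obtain x' u where xu: "w G = (x', u)" "x' \<in> X" "u \<in> I" using wG(1)[OF ne] by (auto simp: \<Omega>_def)
    have "fst G = {1..n}" using GG by (intro fst_random_graph[of G n p]) (auto simp: eq M_def)
    moreover have "(`) x' ` \<Gamma> u \<subseteq> snd G" using wG(2)[OF ne] by (simp add: A'_def F_def xu)
    ultimately have "contains_copy v (\<Gamma> u) G" unfolding contains_copy_def using x[OF xu(2)] by blast
    then have "fo_distinguishability G G' \<le> enat v"
      using nc v xu(1) by (intro fo_distinguishability_le[OF G1[OF xu(3)]]) auto
    then show False using GG by (simp add: eq)
  qed simp
  also have "\<dots> \<le> measure_pmf.prob M (fst -` {G. \<forall>w\<in>\<Omega>. G \<notin> A' w}) + measure_pmf.prob M {(G, G'). Q G G'}"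
    by (rule measure_Un_le) auto
  also have "measure_pmf.prob M (fst -` {G. \<forall>w\<in>\<Omega>. G \<notin> A' w}) =
      measure_pmf.prob (random_graph n p) {G. \<forall>w\<in>\<Omega>. G \<notin> A' w}"
    unfolding M_def by (metis measure_map_pmf map_fst_pair_pmf)
  finally show ?thesis using bad1 bad2 by (simp add: M_def e_def)
qed

subsection \<open>Distribution of the slots along the path\<close>

text \<open>The falling factorial is at least \<open>(n - v) ^ v\<close>, and Bernoulli's inequality
  bounds this from below.\<close>

lemma card_injections_ge:
  assumes "v \<le> n" "n > 0"
  shows "real n ^ v * (1 - real v ^ 2 / n) \<le> card {x \<in> {..<v} \<rightarrow>\<^sub>E {1..n}. inj_on x {..<v}}"
proof -
  have "real n ^ v * (1 - real v ^ 2 / n) \<le> real n ^ v * (1 + real v * (- (real v / n)))"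
    by (simp add: power2_eq_square)
  also have "\<dots> \<le> real n ^ v * (1 + (- (real v / n))) ^ v"
    using assms by (intro mult_left_mono Bernoulli_inequality) (auto simp: field_simps)
  also have "\<dots> = (real n - v) ^ v"
    using assms by (simp add: field_simps flip: power_mult_distrib)
  also have "\<dots> = (\<Prod>i<v. real n - v)" by simp
  also have "\<dots> \<le> (\<Prod>i<v. real (n - i))"
    using assms by (intro prod_mono) (auto simp: of_nat_diff)
  also have "\<dots> = card {x \<in> {..<v} \<rightarrow>\<^sub>E {1..n}. inj_on x {..<v}}"
    using card_inj_on_subset_funcset[of "{..<v}" "{1..n}" "{..<v}"] by (simp add: atLeast0LessThan)
  finally show ?thesis .
qed

text \<open>With \<open>S i\<close> as the number of slots of the first \<open>i\<close> path
  vertices, slot \<open>k\<close> belongs to the \<open>i\<close> with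
  \<open>S i \<le> k < S (Suc i)\<close>.\<close>

lemma slot_owners:
  fixes S :: "nat \<Rightarrow> nat"
  assumes "mono S" "S 0 = 0"
  obtains q :: "nat \<Rightarrow> nat" where "\<And>k. k < S v \<Longrightarrow> q k < v"
    "\<And>i. card {k. k < S v \<and> q k = i} \<le> S (Suc i) - S i"
proof
  define q where "q k = (LEAST i. k < S (Suc i))" for k
  have ex: "v > 0 \<and> k < S (Suc (v - 1))" if "k < S v" for k
    using that assms(2) by (cases v) auto
  show "q k < v" if "k < S v" for k
    using ex[OF that] that Least_le[of "\<lambda>i. k < S (Suc i)" "v - 1"] by (auto simp: q_def)
  have "{k. k < S v \<and> q k = i} \<subseteq> {S i..<S (Suc i)}" for i
  proof clarify
    fix k assume k: "k < S v" "i = q k"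
    have "k < S (Suc (q k))" unfolding q_def using conjunct2[OF ex[OF k(1)]] by (rule LeastI[of "\<lambda>i. k < S (Suc i)"])
    moreover have "S (q k) \<le> k"
    proof (cases "q k")
      case (Suc j)
      then have "\<not> k < S (Suc j)" using not_less_Least[of j "\<lambda>i. k < S (Suc i)"] by (simp add: q_def)
      then show ?thesis using Suc by simp
    qed (simp add: assms)
    ultimately show "k \<in> {S (q k)..<S (Suc (q k))}" by simp
  qed
  then show "card {k. k < S v \<and> q k = i} \<le> S (Suc i) - S i" for i
    using card_mono[of "{S i..<S (Suc i)}" "{k. k < S v \<and> q k = i}"] by simp
qed

text \<open>The explicit solution of the walk recursion. The summand \<open>j\<close> stands for a
  shared run of the path vertices from \<open>j\<close> to \<open>k - 1\<close>: each vertex costs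
  \<open>1 / n\<close>, each of the \<open>k - j - 1\<close> path edges gives \<open>B\<close>, and
  each slot in the run gives \<open>A\<close>. One step of the recursion prolongs every run or
  starts a new one at \<open>k\<close>.\<close>

lemma walk_recursion_solution:
  fixes A B n c :: real and S :: "nat \<Rightarrow> nat"
  assumes "mono S" "B \<ge> 0" "n > 0" "A \<ge> 0" "c \<le> A ^ (S (Suc k) - S k)"
  shows "c * (1 + B * (\<Sum>j<k. B ^ (k - j - 1) * A ^ (S k - S j) / n ^ (k - j))) / n \<le>
    (\<Sum>j<Suc k. B ^ (Suc k - j - 1) * A ^ (S (Suc k) - S j) / n ^ (Suc k - j))"
proof -
  define r where "r = (\<Sum>j<k. B ^ (k - j - 1) * A ^ (S k - S j) / n ^ (k - j))"
  define d where "d = S (Suc k) - S k"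
  have "r \<ge> 0" unfolding r_def using assms by (intro sum_nonneg) auto
  have "B ^ (Suc k - j - 1) * A ^ (S (Suc k) - S j) / n ^ (Suc k - j) =
      A ^ d * B / n * (B ^ (k - j - 1) * A ^ (S k - S j) / n ^ (k - j))" if "j < k" for j
  proof -
    have "Suc k - j - 1 = Suc (k - j - 1)" "Suc k - j = Suc (k - j)" using that by auto
    moreover have "S (Suc k) - S j = d + (S k - S j)"
      using monoD[OF assms(1), of j k] monoD[OF assms(1), of k "Suc k"] that by (simp add: d_def)
    ultimately show ?thesis by (simp add: power_add)
  qed
  then have "(\<Sum>j<Suc k. B ^ (Suc k - j - 1) * A ^ (S (Suc k) - S j) / n ^ (Suc k - j)) =
      A ^ d * B / n * r + A ^ d / n"
    by (simp add: r_def d_def sum_distrib_left)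
  also have "\<dots> = A ^ d * (1 + B * r) / n" by (simp add: algebra_simps add_divide_distrib)
  finally show ?thesis
    unfolding r_def[symmetric] using assms \<open>r \<ge> 0\<close>
    by (simp add: d_def divide_right_mono mult_right_mono)
qed

text \<open>Only finitely many pairs \<open>(l, s)\<close> are concerned, and a zero would give
  \<open>\<alpha> = l / (s + l - 1)\<close>, a rational number.\<close>

lemma irrational_gap:
  fixes \<alpha> M :: real
  assumes "\<alpha> \<notin> \<rat>"
  obtains x where "x > 0"
    "\<And>(l::nat) (s::nat). (1::nat) \<le> l \<Longrightarrow> real l \<le> M \<Longrightarrow> s < N \<Longrightarrow> x \<le> \<bar>\<alpha> * (real s - 1) - (1 - \<alpha>) * l\<bar>"
proof -
  define f where "f = (\<lambda>(l, s). \<bar>\<alpha> * (real s - 1) - (1 - \<alpha>) * real l\<bar>)"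
  \<comment> \<open>The element 1 keeps \<open>T\<close> nonempty, so that its minimum exists even
    if no pair is in range.\<close>
  define T where "T = insert 1 (f ` ({1..nat \<lfloor>M\<rfloor>} \<times> {..<N}))"
  have T: "finite T" "T \<noteq> {}" by (auto simp: T_def)
  have ne: "f (l, s) > 0" if "1 \<le> l" for l s :: nat
  proof (rule ccontr)
    assume "\<not> ?thesis"
    then have *: "\<alpha> * (real s + real l - 1) = real l" by (simp add: f_def algebra_simps)
    have "real s + real l - 1 \<noteq> 0" using * that by auto
    then have "\<alpha> = real l / (real s + real l - 1)" using * by (simp add: field_simps)
    also have "\<dots> \<in> \<rat>" by simp
    finally show False using assms by simp
  qed
  have pos: "Min T > 0" using T ne by (subst Min_gr_iff) (auto simp: T_def)
  have le: "Min T \<le> \<bar>\<alpha> * (real s - 1) - (1 - \<alpha>) * l\<bar>" if "1 \<le> l" "l \<le> M" "s < N" for l s :: nat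
  proof -
    have "l \<le> nat \<lfloor>M\<rfloor>" using that by (simp add: le_nat_floor)
    then have "f (l, s) \<in> T" using that by (auto simp: T_def)
    then show ?thesis using T by (auto simp: f_def)
  qed
  show ?thesis by (rule that[OF pos le]) auto
qed

text \<open>The cost of a shared run of \<open>l\<close> vertices with \<open>s\<close> slots is
  governed by \<open>n powr y\<close> with
  \<open>y = \<alpha> * (s - 1) - (1 - \<alpha>) * l\<close>, times a factor
  \<open>L powr (- (1/2))\<close> per slot for the freedom of its target. The exponent -4 is chosen
  so that a sum of order \<open>v ^ 3\<close> of such terms, with \<open>v\<close> at most of order
  \<open>L\<close>, still tends to 0.\<close>

lemma slot_interval_bound:
  fixes \<alpha> \<eta> \<theta> L n P A x :: real and \<Delta> b l s :: nat
  assumes \<alpha>: "0 < \<alpha>" "\<alpha> < 1" and \<eta>: "0 < \<eta>" "\<eta> < \<alpha>" "\<eta> = ln L / (4 * L)" and \<theta>: "\<theta> = (1 - \<alpha>) / (\<alpha> - \<eta>)"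
    and L: "L = ln n" "1 \<le> L" and "n > 0" and P: "P = n powr \<alpha>"
    and A: "0 \<le> A" "A \<le> P * L powr (- (1/2)) / real \<Delta> ^ b" and \<Delta>: "1 \<le> \<Delta>" and b: "\<alpha> / (1 - \<alpha>) \<le> b"
    and l: "1 \<le> l" and s: "\<theta> * l - 1 < s" "s < \<theta> * l + 1"
    and x: "1 \<le> l \<Longrightarrow> l \<le> 16 * b \<Longrightarrow> s < 16 \<Longrightarrow> x \<le> \<bar>\<alpha> * (real s - 1) - (1 - \<alpha>) * l\<bar>"
      "15 * \<eta> < x" "n powr (- x) \<le> L powr (-4)"
  shows "(P * \<Delta>) ^ (l - 1) * A ^ s / n ^ l \<le> real \<Delta> ^ b * L powr (-4)"
proof -
  define y where "y = \<alpha> * (real s - 1) - (1 - \<alpha>) * l"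
  have P0: "P > 0" using \<open>n > 0\<close> P by simp
  have "n \<ge> 1" using L \<open>n > 0\<close> ln_less_zero[of n] by linarith
  \<comment> \<open>A run cannot be much longer than its number of slots. The powers of \<Delta>
    from its path edges are therefore absorbed, up to \<open>\<Delta> ^ b\<close>, by the factor
    \<open>1 / \<Delta> ^ b\<close> per slot in the bound on \<open>A\<close>.\<close>
  have "real l \<le> b * ((1 - \<alpha>) / \<alpha>) * l"
  proof -
    have "1 \<le> b * ((1 - \<alpha>) / \<alpha>)" using b \<alpha> by (simp add: field_simps)
    from mult_right_mono[OF this, of "real l"] show ?thesis by simp
  qed
  also have "\<dots> \<le> b * \<theta> * l"
    unfolding \<theta> using \<alpha> \<eta> by (intro mult_right_mono mult_left_mono divide_left_mono) auto
  also have "\<dots> \<le> b * (real s + 1)" using s(1) by (simp add: mult.assoc mult_left_mono)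
  finally have lb: "real l \<le> b * (real s + 1)" .
  then have lb': "l \<le> b * (s + 1)" by (metis of_nat_1 of_nat_add of_nat_le_iff of_nat_mult)
  have "(\<alpha> - \<eta>) * (real s - 1) \<le> (1 - \<alpha>) * l"
    using s(2) \<alpha> \<eta>(1,2) by (simp add: \<theta> field_simps)
  then have y\<eta>: "y \<le> \<eta> * (real s - 1)" by (simp add: y_def algebra_simps)
  have "(P * \<Delta>) ^ (l - 1) * A ^ s / n ^ l \<le>
      (P * \<Delta>) ^ (l - 1) * (P * L powr (- (1/2)) / real \<Delta> ^ b) ^ s / n ^ l"
    using A P0 \<open>n > 0\<close> by (intro divide_right_mono mult_left_mono power_mono) auto
  also have "\<dots> = (real \<Delta> ^ (l - 1) / real \<Delta> ^ (b * s)) * (P ^ (l - 1 + s) / n ^ l) * (L powr (- (1/2))) ^ s"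
    by (simp add: power_mult_distrib power_divide power_add power_mult)
  also have "P ^ (l - 1 + s) / n ^ l = n powr y"
  proof -
    have "P ^ (l - 1 + s) / n ^ l = n powr (\<alpha> * (l - 1 + s)) / n powr l"
      using \<open>n > 0\<close> by (simp add: P powr_power powr_realpow mult.commute)
    also have "\<dots> = n powr (\<alpha> * (l - 1 + s) - l)" by (simp add: powr_diff)
    also have "\<alpha> * real (l - 1 + s) - l = y" using l by (simp add: y_def of_nat_diff algebra_simps)
    finally show ?thesis by simp
  qed
  also have "(L powr (- (1/2))) ^ s = L powr (- (s / 2))" using L by (simp add: powr_power)
  also have "(real \<Delta> ^ (l - 1) / real \<Delta> ^ (b * s)) * n powr y * L powr (- (s / 2)) \<le> real \<Delta> ^ b * (n powr y * L powr (- (s / 2)))"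
  proof -
    have "real \<Delta> ^ (l - 1) \<le> real \<Delta> ^ (b * s + b)" using lb' \<Delta> by (intro power_increasing) auto
    then have "real \<Delta> ^ (l - 1) / real \<Delta> ^ (b * s) \<le> real \<Delta> ^ b"
      using \<Delta> by (simp add: power_add field_simps)
    then have "real \<Delta> ^ (l - 1) / real \<Delta> ^ (b * s) * (n powr y * L powr (- (s / 2))) \<le>
        real \<Delta> ^ b * (n powr y * L powr (- (s / 2)))"
      by (intro mult_right_mono) auto
    then show ?thesis by (simp only: mult.assoc)
  qed
  also have "\<dots> \<le> real \<Delta> ^ b * L powr (-4)"
  proof (rule mult_left_mono)
    show "n powr y * L powr (- (s / 2)) \<le> L powr (-4)"
    proof (cases "s < 16")
      \<comment> \<open>Few slots: \<open>l\<close> and \<open>s\<close> are bounded, so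
        \<open>y\<close> has distance at least \<open>x\<close> from 0 by irrationality;
        \<open>y \<le> 15 * \<eta> < x\<close> leaves only the negative side.\<close>
      case True
      then have "b * (s + 1) \<le> b * 16" by (intro mult_le_mono2) simp
      then have "l \<le> 16 * b" using lb' by linarith
      then have xy: "x \<le> \<bar>y\<bar>" using x(1)[OF l _ True] by (simp add: y_def)
      have "\<eta> * (real s - 1) \<le> \<eta> * 15" using True \<eta> by (intro mult_left_mono) auto
      then have "y < x" using y\<eta> x(2) by linarith
      then have "y \<le> - x" using xy by linarith
      then have "n powr y \<le> n powr (- x)" using \<open>n \<ge> 1\<close> by (rule powr_mono)
      moreover have "L powr (- (s / 2)) \<le> L powr 0" using L by (intro powr_mono) auto
      ultimately have "n powr y * L powr (- (s / 2)) \<le> L powr (-4) * 1"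
        using x(3) L by (intro mult_mono) auto
      then show ?thesis by simp
    next
      \<comment> \<open>Many slots: \<open>n powr (\<eta> * s)\<close> is
        \<open>L powr (s / 4)\<close>, half of the gain \<open>L powr (- (s / 2))\<close> in the
        exponent; the remaining \<open>s / 4\<close> is at least 4.\<close>
      case False
      have "n powr y \<le> n powr (\<eta> * s)"
        using y\<eta> \<eta>(1) \<open>n \<ge> 1\<close> by (intro powr_mono) (auto simp: algebra_simps)
      also have "\<dots> = L powr (s / 4)"
        using L \<open>n > 0\<close> \<eta>(3) by (simp add: powr_def L(1)[symmetric])
      finally have "n powr y * L powr (- (s / 2)) \<le> L powr (s / 4) * L powr (- (s / 2))"
        by (intro mult_right_mono) auto
      also have "\<dots> = L powr (- (s / 4))" by (simp flip: powr_add)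
      also have "\<dots> \<le> L powr (-4)" using False L by (intro powr_mono) auto
      finally show ?thesis .
    qed
  qed simp
  finally show ?thesis .
qed

subsection \<open>Asymptotics\<close>

text \<open>Here \<epsilon> accounts for shapes missing in the first graph and \<open>1 / n\<close>
  for the selected shape appearing in the second. The value of \<kappa> makes the excess of edges
  outweigh the loss of \<open>2 * \<alpha>\<close> in the exponent by 1.\<close>

lemma eventually_indistinguishable_prob_le:
  fixes \<alpha> \<epsilon> :: real
  assumes \<alpha>: "0 < \<alpha>" "\<alpha> < 1" "\<alpha> \<notin> \<rat>" and "\<epsilon> > 0"
  defines "\<kappa> \<equiv> 8 * \<alpha> * (2 * \<alpha> + 1) / (1 - \<alpha>)"
  shows "\<forall>\<^sub>F n in sequentially.
    measure_pmf.prob (pair_pmf (random_graph n (real n powr - \<alpha>)) (random_graph n (real n powr - \<alpha>)))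
      {(G1, G2). \<not> fo_distinguishability G1 G2 \<le> enat (nat \<lfloor>\<kappa> * (ln n / ln (ln n))\<rfloor>)} \<le> \<epsilon> + 1 / n"
proof -

  \<comment> \<open>Constants depending only on \<alpha>\<close>
  define \<theta>0 where "\<theta>0 = (1 - \<alpha>) / \<alpha>"
  \<comment> \<open>The size of \<open>D\<close> ensures that at most \<open>v div 4\<close>
    vertices are saturated, with slope at most \<open>2 * \<theta>0\<close> and
    \<open>v / 8 \<le> v div 4\<close>; \<open>R\<close> bounds the slots of a single path
    vertex.\<close>
  define D where "D = nat \<lceil>16 * (1 + 2 * \<theta>0)\<rceil> + 2"
  define R where "R = nat \<lceil>2 * \<theta>0\<rceil> + 1"
  define \<Delta> where "\<Delta> = D + R"
  define b where "b = nat \<lceil>\<alpha> / (1 - \<alpha>)\<rceil>"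
  define B where "B = real \<Delta> ^ b"
  have \<kappa>: "\<kappa> > 0" using \<alpha> by (simp add: \<kappa>_def)
  have \<theta>0: "\<theta>0 > 0" using \<alpha> by (simp add: \<theta>0_def)
  have R_ge: "2 * \<theta>0 + 1 \<le> real R"
    unfolding R_def of_nat_add using real_nat_ceiling_ge[of "2 * \<theta>0"] by linarith
  have D_ge: "16 * (1 + 2 * \<theta>0) \<le> real D"
    unfolding D_def of_nat_add using real_nat_ceiling_ge[of "16 * (1 + 2 * \<theta>0)"] by linarith
  have \<Delta>: "\<Delta> \<ge> 1" by (simp add: \<Delta>_def R_def)
  then have B: "B \<ge> 1" by (simp add: B_def)
  have b: "\<alpha> / (1 - \<alpha>) \<le> b" unfolding b_def by (rule real_nat_ceiling_ge)
  obtain x where x: "x > 0"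
    "\<And>(l::nat) (s::nat). (1::nat) \<le> l \<Longrightarrow> real l \<le> real (16 * b) \<Longrightarrow> s < 16 \<Longrightarrow> x \<le> \<bar>\<alpha> * (real s - 1) - (1 - \<alpha>) * l\<bar>"
    by (rule irrational_gap[OF \<alpha>(3), of "real (16 * b)" 16]) auto
  define L where "L n = ln (real n)" for n :: nat
  \<comment> \<open>The three bounds on \<eta> are used for
    \<open>\<theta> \<le> 2 * \<theta>0\<close>, for the excess of edges, and for runs with few
    slots, respectively.\<close>
  define c\<^sub>0 where "c\<^sub>0 = min (min (\<alpha> / 2) (\<kappa> / 8)) (x / 15)"
  have c0: "c\<^sub>0 > 0" using \<alpha> \<kappa> x by (simp add: c\<^sub>0_def)
  define c\<^sub>1 where "c\<^sub>1 = 8 * (real \<Delta> * B) + 1"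
  have c1: "c\<^sub>1 > 0" using B \<Delta> by (simp add: c\<^sub>1_def add_nonneg_pos)
  have "\<forall>\<^sub>F n in sequentially. L n \<ge> 3" unfolding L_def by real_asymp
  moreover have "\<forall>\<^sub>F n in sequentially. ln (L n) \<ge> 1" unfolding L_def by real_asymp
  moreover have "\<forall>\<^sub>F n in sequentially. ln (L n) / (4 * L n) < c\<^sub>0" unfolding L_def using c0 by real_asymp
  moreover have "\<forall>\<^sub>F n in sequentially. real (4 * (\<Delta> + 10)) \<le> \<kappa> * L n / ln (L n) - 1"
    unfolding L_def using \<kappa> by real_asymp
  moreover have "\<forall>\<^sub>F n in sequentially. c\<^sub>1 * L n powr (1/2) \<le> \<kappa> * L n / ln (L n) - 1"
    unfolding L_def using \<kappa> c1 by real_asymp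
  moreover have "\<forall>\<^sub>F n in sequentially. c\<^sub>1 * L n powr (1/2) \<le> real n powr \<alpha>"
    unfolding L_def using \<alpha> c1 by real_asymp
  moreover have "\<forall>\<^sub>F n in sequentially. real n powr (- x) \<le> L n powr (-4)"
    unfolding L_def using x(1) by real_asymp
  \<comment> \<open>The exponential bounds all correlations, and the last factor is the loss from
    restricting to injective placements; both tend to 1.\<close>
  moreover have "\<forall>\<^sub>F n in sequentially. exp (\<kappa> ^ 3 * B / L n) \<le> (1 + \<epsilon>) * (1 - \<kappa>\<^sup>2 * L n ^ 2 / n)"
    unfolding L_def using \<kappa> B \<open>\<epsilon> > 0\<close> by real_asymp
  moreover have "\<forall>\<^sub>F n in sequentially. \<kappa> * L n / n < 1"
    unfolding L_def using \<kappa> by real_asymp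
  moreover have "\<forall>\<^sub>F n in sequentially. (n::nat) \<ge> 1" by (rule eventually_ge_at_top)
  ultimately show ?thesis
  proof eventually_elim
    case (elim n)

    \<comment> \<open>Parameters for a fixed \<open>n\<close>\<close>
    define \<eta> where "\<eta> = ln (L n) / (4 * L n)"
    \<comment> \<open>The slope slightly exceeds the critical \<open>\<theta>0\<close>. With this
      \<eta>, \<open>n powr \<eta>\<close> is only \<open>L n powr (1/4)\<close>, which the second
      moment tolerates, while \<open>v * \<eta>\<close> is about \<open>\<kappa> / 4\<close>, which
      makes the shapes too rich in edges for the second graph.\<close>
    define \<theta> where "\<theta> = (1 - \<alpha>) / (\<alpha> - \<eta>)"
    define v where "v = nat \<lfloor>\<kappa> * (ln n / ln (ln n))\<rfloor>"
    \<comment> \<open>A Beatty sequence: every run of \<open>l\<close> path vertices has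
      \<open>\<theta> * l\<close> slots up to an error below 1.\<close>
    define S where "S i = nat \<lfloor>\<theta> * real i\<rfloor>" for i :: nat
    define p where "p = real n powr - \<alpha>"
    define P where "P = real n powr \<alpha>"
    \<comment> \<open>Half of the vertices remain as targets; a quarter may be saturated, and the
      rest covers \<open>i\<close> and its neighbours.\<close>
    define m where "m = v div 2"
    define A where "A = 1 + P * \<Delta> / m"
    have n: "n > 0" using elim by simp
    have L: "L n \<ge> 3" "ln (L n) \<ge> 1" using elim by auto
    have \<eta>: "0 < \<eta>" "\<eta> < \<alpha> / 2" "\<eta> < \<kappa> / 8" "15 * \<eta> < x"
      using elim L by (auto simp: \<eta>_def c\<^sub>0_def)
    have "(1 - \<alpha>) / (\<alpha> - \<eta>) \<le> (1 - \<alpha>) / (\<alpha> / 2)"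
      using \<alpha> \<eta> by (intro divide_left_mono mult_pos_pos) auto
    then have \<theta>: "\<theta>0 \<le> \<theta>" "\<theta> \<le> 2 * \<theta>0"
      using \<alpha> \<eta> by (auto simp: \<theta>_def \<theta>0_def mult.commute intro!: divide_left_mono)
    have \<theta>': "\<theta> \<ge> 0" using \<theta> \<theta>0 by simp
    have v_le: "v \<le> \<kappa> * L n / ln (L n)"
      using \<kappa> L by (simp add: v_def L_def)
    have v_ge: "\<kappa> * L n / ln (L n) - 1 \<le> v"
      unfolding v_def L_def by (simp add: of_nat_nat) linarith
    have v4: "4 * (\<Delta> + 10) \<le> v" using v_ge elim(4) by linarith
    have v_le': "v \<le> \<kappa> * L n"
      using v_le L \<kappa> divide_left_mono[of 1 "ln (L n)" "\<kappa> * L n"] by simp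
    have vn: "v \<le> n" using v_le' elim(9) n by (simp add: field_simps)
    have S_real: "\<theta> * i - 1 < S i" "S i \<le> \<theta> * i" for i
      using \<theta>' by (auto simp: S_def of_nat_nat)
    have S_mono: "mono S"
      unfolding S_def mono_def using \<theta>' by (auto intro!: nat_mono floor_mono mult_left_mono)
    have S0: "S 0 = 0" by (simp add: S_def)
    have S_R: "S (Suc i) - S i \<le> R" for i
    proof -
      have "real (S (Suc i)) < \<theta> + real (S i) + 1" using S_real(2)[of "Suc i"] S_real(1)[of i] by (simp add: algebra_simps)
      also have "\<dots> \<le> real (S i) + R" using \<theta> R_ge by linarith
      finally show ?thesis by linarith
    qed
    define K where "K = S v"
    obtain q :: "nat \<Rightarrow> nat" where q: "\<And>k. k < K \<Longrightarrow> q k < v"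
      "\<And>i. card {k. k < K \<and> q k = i} \<le> S (Suc i) - S i"
      unfolding K_def by (rule slot_owners[OF S_mono S0, of v]) auto
    define \<rho> where "\<rho> k = (\<Sum>j<k. (P * \<Delta>) ^ (k - j - 1) * A ^ (S k - S j) / real n ^ (k - j))" for k
    have P1: "P \<ge> 1" unfolding P_def using n \<alpha> by (intro ge_one_powr_ge_zero) auto
    have A1: "A \<ge> 1" using P1 by (simp add: A_def)
    have Pp: "P = 1 / p" by (simp add: P_def p_def powr_minus field_simps)
    have \<rho>0: "\<rho> k \<ge> 0" for k unfolding \<rho>_def using P1 A1 by (intro sum_nonneg) auto
    have \<rho>_Suc: "A ^ card {k'. k' < K \<and> q k' = k} * (1 + P * \<Delta> * \<rho> k) / n \<le> \<rho> (Suc k)" for k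
      unfolding \<rho>_def using A1 P1 n q(2)[of k]
      by (intro walk_recursion_solution S_mono power_increasing) auto
    have m: "real v / 4 \<le> m" "m > 0" using v4 by (auto simp: m_def)
    \<comment> \<open>As \<open>v\<close> is of order \<open>L n / ln (L n)\<close>, it exceeds any
      constant times \<open>L n powr (1/2)\<close>; the two summands of \<open>A\<close> take half
      of the bound each.\<close>
    have A_le: "A \<le> P * L n powr (- (1/2)) / real \<Delta> ^ b"
    proof -
      have Lp: "L n powr (1/2) > 0" using L by simp
      have "c\<^sub>1 * L n powr (1/2) \<le> v" using v_ge elim(5) by linarith
      then have "8 * (\<Delta> * B) * L n powr (1/2) \<le> v"
        using Lp unfolding c\<^sub>1_def distrib_right by linarith
      then have "2 * (\<Delta> * B) * L n powr (1/2) \<le> m" using m by simp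
      then have 1: "\<Delta> / m \<le> 1 / (2 * B * L n powr (1/2))"
        using m(2) B Lp by (simp add: field_simps)
      have "2 * B \<le> 8 * (\<Delta> * B)" using B \<Delta> by simp
      then have "2 * B \<le> c\<^sub>1" unfolding c\<^sub>1_def by linarith
      then have "2 * B * L n powr (1/2) \<le> c\<^sub>1 * L n powr (1/2)"
        using Lp by (intro mult_right_mono) auto
      also have "\<dots> \<le> P" using elim(6) by (simp add: P_def)
      finally have 2: "1 \<le> P * (1 / (2 * B * L n powr (1/2)))"
        using B Lp by (simp add: field_simps)
      have "A = 1 + P * (\<Delta> / m)" by (simp add: A_def)
      also have "\<dots> \<le> P * (1 / (2 * B * L n powr (1/2))) + P * (1 / (2 * B * L n powr (1/2)))"
        using 1 2 P1 by (intro add_mono mult_left_mono) auto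
      also have "\<dots> = P * L n powr (- (1/2)) / B" by (simp add: powr_minus field_simps)
      finally show ?thesis by (simp add: B_def)
    qed

    \<comment> \<open>The second moment condition\<close>
    have term_le: "(P * \<Delta>) ^ (k - j - 1) * A ^ (S k - S j) / real n ^ (k - j) \<le> B * L n powr (-4)"
      if "j < k" for j k
      unfolding B_def
    proof (rule slot_interval_bound[OF \<alpha>(1,2) \<eta>(1) _ \<eta>_def \<theta>_def L_def _ _ P_def _ A_le \<Delta> b, where x = x])
      have Sjk: "S j \<le> S k" by (rule monoD[OF S_mono less_imp_le[OF that]])
      have jk: "real (k - j) = real k - real j" using that by simp
      show "\<theta> * real (k - j) - 1 < real (S k - S j)" "real (S k - S j) < \<theta> * real (k - j) + 1"
        using S_real[of k] S_real[of j] unfolding jk of_nat_diff[OF Sjk] right_diff_distrib by linarith+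
      show "x \<le> \<bar>\<alpha> * (real (S k - S j) - 1) - (1 - \<alpha>) * real (k - j)\<bar>"
        if "1 \<le> k - j" "k - j \<le> 16 * b" "S k - S j < 16"
        using that(2) by (intro x(2)[OF that(1) _ that(3)] of_nat_mono)
    qed (use L \<eta> \<alpha> n A1 elim(7) that in auto)
    have \<rho>_le: "v * \<rho> (Suc i) \<le> real v ^ 2 * (B * L n powr (-4))" if "i < v" for i
    proof -
      have "\<rho> (Suc i) \<le> (\<Sum>j<Suc i. B * L n powr (-4))"
        unfolding \<rho>_def by (intro sum_mono term_le) auto
      also have "\<dots> = real (Suc i) * (B * L n powr (-4))" by simp
      also have "\<dots> \<le> v * (B * L n powr (-4))" using that B by (intro mult_right_mono) auto
      finally have "v * \<rho> (Suc i) \<le> v * (v * (B * L n powr (-4)))" by (intro mult_left_mono) auto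
      then show ?thesis by (simp add: power2_eq_square)
    qed
    \<comment> \<open>By \<open>1 + t \<le> exp t\<close> the product is at most
      \<open>exp (real v ^ 3 * (B * L n powr (-4)))\<close>, and
      \<open>v \<le> \<kappa> * L n\<close> makes the exponent of order
      \<open>1 / L n\<close>.\<close>
    have "(\<Prod>i<v. 1 + v * \<rho> (Suc i)) \<le> (\<Prod>i<v. exp (real v ^ 2 * (B * L n powr (-4))))"
    proof (rule prod_mono, intro conjI)
      fix i assume "i \<in> {..<v}"
      then have "1 + v * \<rho> (Suc i) \<le> 1 + real v ^ 2 * (B * L n powr (-4))" using \<rho>_le by simp
      also have "\<dots> \<le> exp (real v ^ 2 * (B * L n powr (-4)))" by (rule exp_ge_add_one_self)
      finally show "1 + v * \<rho> (Suc i) \<le> exp (real v ^ 2 * (B * L n powr (-4)))" .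
    qed (use \<rho>0 in auto)
    also have "\<dots> = exp (real v ^ 3 * (B * L n powr (-4)))"
      by (simp add: power2_eq_square power3_eq_cube mult_ac flip: exp_of_nat_mult)
    also have "\<dots> \<le> exp (\<kappa> ^ 3 * B / L n)"
    proof -
      have "real v ^ 3 \<le> (\<kappa> * L n) ^ 3" using v_le' by (intro power_mono) auto
      then have "real v ^ 3 * (B * L n powr (-4)) \<le> (\<kappa> * L n) ^ 3 * (B * L n powr (-4))"
        using B by (intro mult_right_mono) auto
      also have "\<dots> = \<kappa> ^ 3 * B / L n"
        using L by (simp add: powr_minus powr_numeral power_mult_distrib field_simps eval_nat_numeral)
      finally show ?thesis by simp
    qed
    also have "\<dots> \<le> (1 + \<epsilon>) * (1 - \<kappa>\<^sup>2 * L n ^ 2 / n)" using elim(8) .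
    also have "\<dots> \<le> (1 + \<epsilon>) * (1 - real v ^ 2 / n)"
    proof -
      have "real v ^ 2 \<le> (\<kappa> * L n) ^ 2" using v_le' by (intro power_mono) auto
      then show ?thesis using \<open>\<epsilon> > 0\<close> n
        by (intro mult_left_mono diff_left_mono divide_right_mono) (auto simp: power_mult_distrib)
    qed
    finally have prod: "(\<Prod>i<v. 1 + v * \<rho> (Suc i)) \<le> (1 + \<epsilon>) * (1 - real v ^ 2 / n)" .
    define N where "N = card {x \<in> {..<v} \<rightarrow>\<^sub>E {1..n}. inj_on x {..<v}}"
    have N: "real n ^ v * (1 - real v ^ 2 / n) \<le> N"
      unfolding N_def by (rule card_injections_ge[OF vn n])
    have "(\<Prod>i<v. 1 + v * \<rho> (Suc i)) \<ge> 1" using \<rho>0 by (intro prod_ge_1) auto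
    with prod have "0 < (1 + \<epsilon>) * (1 - real v ^ 2 / n)" by linarith
    then have "0 < 1 - real v ^ 2 / n" using \<open>\<epsilon> > 0\<close> by (simp add: zero_less_mult_iff)
    then have "0 < real n ^ v * (1 - real v ^ 2 / n)" using n by simp
    with N have Npos: "N > 0" by linarith
    have "real n ^ v * (\<Prod>i<v. 1 + v * \<rho> (Suc i)) \<le> real n ^ v * ((1 + \<epsilon>) * (1 - real v ^ 2 / n))"
      using prod by (intro mult_left_mono) auto
    also have "\<dots> = (1 + \<epsilon>) * (real n ^ v * (1 - real v ^ 2 / n))" by simp
    also have "\<dots> \<le> (1 + \<epsilon>) * N" using N \<open>\<epsilon> > 0\<close> by (intro mult_left_mono) auto
    finally have NN: "real n ^ v * (\<Prod>i<v. 1 + v * \<rho> (Suc i)) \<le> (1 + \<epsilon>) * N" .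
    have KD: "2 * (v + K) \<le> D * (v div 4)"
    proof -
      have "real K \<le> \<theta> * v" unfolding K_def by (rule S_real)
      also have "\<dots> \<le> 2 * \<theta>0 * v" using \<theta> by (intro mult_right_mono) auto
      finally have "real (2 * (v + K)) \<le> 16 * (1 + 2 * \<theta>0) * (v / 8)" by (simp add: algebra_simps)
      also have "\<dots> \<le> D * real (v div 4)"
      proof (rule mult_mono)
        show "16 * (1 + 2 * \<theta>0) \<le> D" by (rule D_ge)
        have "v \<le> 8 * (v div 4)" using v4 by presburger
        then show "real v / 8 \<le> real (v div 4)" by linarith
      qed auto
      finally show ?thesis by (simp flip: of_nat_mult)
    qed
    have p: "0 < p" "p \<le> 1" using P1 Pp n by (auto simp: p_def powr_minus P_def field_simps)
    have main: "measure_pmf.prob (pair_pmf (random_graph n p) (random_graph n p))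
           {(G1, G2). \<not> fo_distinguishability G1 G2 \<le> enat v} \<le> \<epsilon> + real n ^ v * p ^ (v - 1 + K)"
    proof (rule prob_fo_distinguishability_le[where D = D and m = m and z = "v div 4" and R = R and q = q and \<rho> = \<rho>])
      show "(1 + (D + R) / (p * m)) ^ card {k'. k' < K \<and> q k' = k} * (1 + (D + R) / p * \<rho> k) / n \<le> \<rho> (Suc k)" for k
        using \<rho>_Suc[of k] by (simp add: A_def Pp \<Delta>_def)
      show "card {k. k < K \<and> q k = i} \<le> R" for i using q(2)[of i] S_R[of i] by linarith
      show "v div 4 + D + R + 1 + m \<le> v" using v4 by (simp add: m_def \<Delta>_def)
      show "D \<ge> 2" by (simp add: D_def)
    qed (use m KD q(1) p n \<rho>0 Npos NN in \<open>auto simp: N_def\<close>)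

    \<comment> \<open>Expected number of copies in the second graph\<close>
    have "real n ^ v * p ^ (v - 1 + K) \<le> 1 / n"
    proof -
      have "real n ^ v * p ^ (v - 1 + K) = real n powr (v - \<alpha> * (v - 1 + K))"
        using n by (simp add: p_def powr_realpow[symmetric] powr_powr powr_add[symmetric] algebra_simps)
      also have "\<dots> \<le> real n powr (-1)"
      proof (rule powr_mono)
        have "real v - \<alpha> * real (v - 1 + K) = v * (1 - \<alpha>) + \<alpha> - \<alpha> * K"
          using v4 by (simp add: of_nat_diff algebra_simps)
        \<comment> \<open>One \<alpha> is lost because the path has \<open>v - 1\<close> edges, the
          other by rounding in \<open>S v\<close>. Against this, every vertex gains
          \<open>\<alpha> * \<theta> - (1 - \<alpha>)\<close>, which equals
          \<open>\<eta> * \<theta>\<close>.\<close>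
        also have "\<dots> \<le> v * (1 - \<alpha>) + \<alpha> - \<alpha> * (\<theta> * v - 1)"
          using \<alpha> S_real(1)[of v] by (intro diff_left_mono mult_left_mono) (auto simp: K_def)
        also have "\<dots> = 2 * \<alpha> - v * (\<alpha> * \<theta> - (1 - \<alpha>))" by (simp add: algebra_simps)
        also have "\<dots> \<le> 2 * \<alpha> - (2 * \<alpha> + 1)"
        proof (rule diff_left_mono)
          have "\<kappa> / 8 \<le> \<kappa> / 4 - \<eta>" using \<eta>(3) by linarith
          also have "\<dots> = (\<kappa> * L n / ln (L n) - 1) * \<eta>"
            using L by (simp add: \<eta>_def field_simps)
          also have "\<dots> \<le> v * \<eta>" using v_ge \<eta> by (intro mult_right_mono) auto
          finally have v\<eta>: "\<kappa> / 8 \<le> v * \<eta>" .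
          \<comment> \<open>This equation determines the value of \<kappa>.\<close>
          have "2 * \<alpha> + 1 = \<kappa> / 8 * ((1 - \<alpha>) / \<alpha>)"
            using \<alpha> by (simp add: \<kappa>_def divide_simps)
          also have "\<dots> \<le> v * \<eta> * ((1 - \<alpha>) / (\<alpha> - \<eta>))"
            using v\<eta> \<alpha> \<eta> \<kappa> by (intro mult_mono divide_left_mono) auto
          also have "\<dots> = v * (\<alpha> * \<theta> - (1 - \<alpha>))"
            using \<alpha> \<eta> by (simp add: \<theta>_def field_simps)
          finally show "2 * \<alpha> + 1 \<le> v * (\<alpha> * \<theta> - (1 - \<alpha>))" .
        qed
        finally show "real v - \<alpha> * real (v - 1 + K) \<le> - 1" by simp
      qed (use n in auto)
      also have "\<dots> = 1 / n" using n by (simp add: powr_minus field_simps)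
      finally show ?thesis .
    qed
    with main show ?case by (simp add: p_def v_def)
  qed
qed

section \<open>From the tail bound to stochastic boundedness\<close>

theorem theorem2:
  fixes \<alpha> :: real
  assumes "0 < \<alpha>" and "\<alpha> < 1" and "\<alpha> \<notin> \<rat>"
  shows "bigo_p
           (\<lambda>n. measure_pmf (pair_pmf (random_graph n (real n powr - \<alpha>))
                                       (random_graph n (real n powr - \<alpha>))))
           (\<lambda>n (G1, G2). ereal_of_enat (fo_distinguishability G1 G2))
           (\<lambda>n. ln (real n) / ln (ln (real n)))"
  unfolding bigo_p_def
proof (intro allI impI)
  fix \<epsilon> :: real assume "\<epsilon> > 0"
  define \<kappa> where "\<kappa> = 8 * \<alpha> * (2 * \<alpha> + 1) / (1 - \<alpha>)"
  have \<kappa>: "\<kappa> > 0" using assms by (simp add: \<kappa>_def)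
  have "\<forall>\<^sub>F n in sequentially. 1 / real n < \<epsilon> / 2" using \<open>\<epsilon> > 0\<close> by real_asymp
  moreover have "\<forall>\<^sub>F n in sequentially. ln (real n) / ln (ln (real n)) > 0" by real_asymp
  moreover have "\<forall>\<^sub>F n in sequentially.
    measure_pmf.prob (pair_pmf (random_graph n (real n powr - \<alpha>)) (random_graph n (real n powr - \<alpha>)))
      {(G1, G2). \<not> fo_distinguishability G1 G2 \<le> enat (nat \<lfloor>\<kappa> * (ln n / ln (ln n))\<rfloor>)} \<le> \<epsilon> / 2 + 1 / n"
    unfolding \<kappa>_def using assms \<open>\<epsilon> > 0\<close> by (intro eventually_indistinguishable_prob_le) auto
  ultimately have "\<forall>\<^sub>F n in sequentially. 1 - \<epsilon> <
      measure_pmf.prob (pair_pmf (random_graph n (real n powr - \<alpha>)) (random_graph n (real n powr - \<alpha>)))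
       {x. \<bar>(case x of (G1, G2) \<Rightarrow> ereal_of_enat (fo_distinguishability G1 G2)) /
          ereal (ln (real n) / ln (ln (real n)))\<bar> < ereal (\<kappa> + 1)}"
  proof eventually_elim
    case (elim n)
    define M where "M = pair_pmf (random_graph n (real n powr - \<alpha>)) (random_graph n (real n powr - \<alpha>))"
    define a where "a = ln (real n) / ln (ln (real n))"
    define v where "v = nat \<lfloor>\<kappa> * a\<rfloor>"
    have a: "a > 0" using elim by (simp add: a_def)
    have va: "v \<le> \<kappa> * a" using \<kappa> a by (simp add: v_def)
    define Bad where "Bad = {(G1 :: nat graph, G2 :: nat graph). \<not> fo_distinguishability G1 G2 \<le> enat v}"
    have "- Bad \<subseteq> {x. \<bar>(case x of (G1, G2) \<Rightarrow> ereal_of_enat (fo_distinguishability G1 G2)) /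
          ereal a\<bar> < ereal (\<kappa> + 1)}"
    proof
      fix GG assume "GG \<in> - Bad"
      then obtain G G' where eq: "GG = (G, G')" and "fo_distinguishability G G' \<le> enat v"
        by (cases GG) (auto simp: Bad_def)
      \<comment> \<open>Off \<open>Bad\<close> the distinguishability is bounded by a natural
        number, which excludes the value \<infinity>.\<close>
      then obtain k where k: "fo_distinguishability G G' = enat k" "k \<le> v"
        by (cases "fo_distinguishability G G'") auto
      have "real k / a \<le> \<kappa>" using k(2) va a by (simp add: field_simps)
      then show "GG \<in> {x. \<bar>(case x of (G1, G2) \<Rightarrow> ereal_of_enat (fo_distinguishability G1 G2)) /
          ereal a\<bar> < ereal (\<kappa> + 1)}"
        using a by (simp add: eq k(1))
    qed
    then have "measure_pmf.prob M (- Bad) \<le> measure_pmf.prob M {x. \<bar>(case x of (G1, G2) \<Rightarrow> ereal_of_enat (fo_distinguishability G1 G2)) /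
          ereal a\<bar> < ereal (\<kappa> + 1)}"
      by (intro measure_pmf.finite_measure_mono) auto
    moreover have "measure_pmf.prob M (- Bad) = 1 - measure_pmf.prob M Bad"
      using measure_pmf.prob_compl[of Bad M] by (simp add: Compl_eq_Diff_UNIV)
    moreover have "measure_pmf.prob M Bad \<le> \<epsilon> / 2 + 1 / n"
      using elim(3) by (simp add: M_def Bad_def v_def a_def)
    ultimately show ?case using elim(1) by (simp add: M_def a_def)
  qed
  then show "\<exists>C>0. \<forall>\<^sub>F n in sequentially. 1 - \<epsilon> <
      measure (measure_pmf (pair_pmf (random_graph n (real n powr - \<alpha>)) (random_graph n (real n powr - \<alpha>))))
       {x \<in> space (measure_pmf (pair_pmf (random_graph n (real n powr - \<alpha>)) (random_graph n (real n powr - \<alpha>)))).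
        \<bar>(case x of (G1, G2) \<Rightarrow> ereal_of_enat (fo_distinguishability G1 G2)) /
          ereal (ln (real n) / ln (ln (real n)))\<bar> < ereal C}"
    \<comment> \<open>The quotient is at most \<kappa> off the bad event;
      \<open>\<kappa> + 1\<close> makes the inequality strict.\<close>
    using \<kappa> by (intro exI[of _ "\<kappa> + 1"]) simp
qed

end
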